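(* Let $G$ be a finite cyclic group and let $G_0\subseteq G$ contain at least two generating elements of $G$. Suppose $\min\Delta(G_0)\ge (2|G|^2)^{1/3}$. Then $\min\Delta(G_0)\in I(|G|)$. Moreover, $G_0$ contains exactly two generating elements, say $e$ and $g$, and they satisfy \[\sigma_e(g)=\frac{|G|-c_1}{c_2}\quad\text{and}\quad de=dg\] for some $(c_1,c_2,d)\in M(|G|)$ such that \[\min\Delta(G_0)=\gcd\left\{\frac{|G|-c_1-c_2}{c_1c_2},\ \frac{(|G|-c_1-c_2)d}{c_2|G|}\right\}.\]
   Context: For $G_0\subseteq G$: $\mathcal B(G_0)$ is the monoid of zero-sum sequences over $G_0$ (finite unordered lists of elements of $G_0$ with sum $0$), whose atoms are the minimal zero-sum sequences; $\mathsf L(B)$ is the set of lengths of factorizations of $B$ into minimal zero-sum sequences; for $L=\{\ell_1<\dots<\ell_k\}$, $\Delta(L)=\{\ell_{i+1}-\ell_i\}$; $\Delta(G_0)=\bigcup_B\Delta(\mathsf L(B))$; $\min\Delta(G_0)$ is its minimum, with $\min\emptyset=0$. For a generating element $e$ of a finite cyclic group $G$ and $h\in G$, $\sigma_e(h)$ is the unique $a\in[1,|G|]$ with $h=ae$. For a positive integer $n$: $M(n)$ is the set of triples $(c_1,c_2,d)$ of positive integers with $c_1,c_2\in[1,n]$, $d\mid n$, such that $\frac{n-c_1-c_2}{c_1c_2}$ and $\frac{(n-c_1-c_2)d}{c_2n}$ are positive integers; $I(n)$ is the set of all integers $\gcd\left\{\frac{n-c_1-c_2}{c_1c_2},\frac{(n-c_1-c_2)d}{c_2n}\right\}$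 with $(c_1,c_2,d)\in M(n)$. *)

theory Defs
  imports Complex_Main "HOL-Library.Cardinality" "HOL-Library.Multiset" "HOL-Computational_Algebra.Group_Closure"
begin

text \<open>
  Groups are written additively, as types of class \<open>ab_group_add\<close>; the multiple \<open>k e\<close> with
  \<open>k\<close> a natural number is \<open>iterate_add k e\<close>.
\<close>

definition generating :: "'a::ab_group_add \<Rightarrow> bool" where
  "generating e \<longleftrightarrow> group_closure {e} = UNIV"

text \<open>Only meaningful if \<open>e\<close> is a generating element of a finite group.\<close>

definition sigma :: "'a::{finite, ab_group_add} \<Rightarrow> 'a \<Rightarrow> nat" where
  "sigma e h = (THE a. a \<in> {1..CARD('a)} \<and> h = iterate_add a e)"

definition zero_sum_seqs :: "'a::ab_group_add set \<Rightarrow> 'a multiset set" where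
  "zero_sum_seqs G\<^sub>0 = {S. set_mset S \<subseteq> G\<^sub>0 \<and> \<Sum>\<^sub># S = 0}"

definition minimal_zero_sum_seqs :: "'a::ab_group_add set \<Rightarrow> 'a multiset set" where
  "minimal_zero_sum_seqs G\<^sub>0 =
     {A \<in> zero_sum_seqs G\<^sub>0. A \<noteq> {#} \<and> (\<forall>T. T \<subset># A \<and> T \<noteq> {#} \<longrightarrow> \<Sum>\<^sub># T \<noteq> 0)}"

text \<open>A factorization is a multiset of atoms: the order of the factors is irrelevant.\<close>

definition length_set :: "'a::ab_group_add set \<Rightarrow> 'a multiset \<Rightarrow> nat set" where
  "length_set G\<^sub>0 B = {size F | F. set_mset F \<subseteq> minimal_zero_sum_seqs G\<^sub>0 \<and> \<Sum>\<^sub># F = B}"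

definition successive_distances :: "nat set \<Rightarrow> nat set" where
  "successive_distances L = {m - l | l m. l \<in> L \<and> m \<in> L \<and> l < m \<and> \<not> (\<exists>k\<in>L. l < k \<and> k < m)}"

definition set_of_distances :: "'a::ab_group_add set \<Rightarrow> nat set" where
  "set_of_distances G\<^sub>0 = (\<Union>B\<in>zero_sum_seqs G\<^sub>0. successive_distances (length_set G\<^sub>0 B))"

definition min_distance :: "'a::ab_group_add set \<Rightarrow> nat" where
  "min_distance G\<^sub>0 =
     (if set_of_distances G\<^sub>0 = {} then 0 else LEAST k. k \<in> set_of_distances G\<^sub>0)"

text \<open>The two fractions are formed in the reals, so no subtraction or division truncates.\<close>

definition quot1 :: "nat \<Rightarrow> nat \<Rightarrow> nat \<Rightarrow> real" where
  "quot1 n c\<^sub>1 c\<^sub>2 = (real n - real c\<^sub>1 - real c\<^sub>2) / (real c\<^sub>1 * real c\<^sub>2)"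

definition quot2 :: "nat \<Rightarrow> nat \<Rightarrow> nat \<Rightarrow> nat \<Rightarrow> real" where
  "quot2 n c\<^sub>1 c\<^sub>2 d = (real n - real c\<^sub>1 - real c\<^sub>2) * real d / (real c\<^sub>2 * real n)"

definition M_set :: "nat \<Rightarrow> (nat \<times> nat \<times> nat) set" where
  "M_set n = {(c\<^sub>1, c\<^sub>2, d). c\<^sub>1 \<in> {1..n} \<and> c\<^sub>2 \<in> {1..n} \<and> 0 < d \<and> d dvd n \<and>
     quot1 n c\<^sub>1 c\<^sub>2 \<in> \<int> \<and> 0 < quot1 n c\<^sub>1 c\<^sub>2 \<and>
     quot2 n c\<^sub>1 c\<^sub>2 d \<in> \<int> \<and> 0 < quot2 n c\<^sub>1 c\<^sub>2 d}"

text \<open>On \<open>M_set n\<close> both quotients are integers, so \<open>floor\<close> only converts them to type \<open>int\<close>.\<close>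

definition quot_gcd :: "nat \<Rightarrow> nat \<Rightarrow> nat \<Rightarrow> nat \<Rightarrow> int" where
  "quot_gcd n c\<^sub>1 c\<^sub>2 d = gcd \<lfloor>quot1 n c\<^sub>1 c\<^sub>2\<rfloor> \<lfloor>quot2 n c\<^sub>1 c\<^sub>2 d\<rfloor>"

definition I_set :: "nat \<Rightarrow> int set" where
  "I_set n = {quot_gcd n c\<^sub>1 c\<^sub>2 d | c\<^sub>1 c\<^sub>2 d. (c\<^sub>1, c\<^sub>2, d) \<in> M_set n}"

end

theory Submission
  imports Defs "HOL-Number_Theory.Cong"
begin

text \<open>
  Let \<open>n = |G|\<close>, let \<open>m\<close> be the minimal distance, and for a generator \<open>e\<close> in \<open>G\<^sub>0\<close> let the norm of a
  zero-sum sequence be \<open>1/n\<close> times the sum of \<open>\<sigma>\<^sub>e\<close> over its terms. The differences of factorization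
  lengths form the group \<open>m\<int>\<close>, so \<open>m\<close> is the gcd of the numbers \<open>norm(A) - 1\<close>, \<open>A\<close> an atom; since \<open>m\<close> is
  large, an atom of norm at most \<open>m\<close> has norm 1. For two generators \<open>e \<noteq> g\<close> the atoms over \<open>{e, g}\<close> are
  the minimal solutions of \<open>x + \<sigma>\<^sub>e(g) y \<equiv> 0\<close> modulo \<open>n\<close>, and \<open>m\<^sup>2 \<ge> n\<close> forces
  \<open>\<sigma>\<^sub>e(g) = k r + 1\<close>, \<open>\<sigma>\<^sub>g(e) = k q + 1\<close>, \<open>n = q r k + q + r\<close> with \<open>m\<close> dividing \<open>k\<close>; thus
  \<open>c\<^sub>1 = r\<close> and \<open>c\<^sub>2 = q\<close>. The same applies to \<open>t e\<close> and any \<open>h\<close> in \<open>G\<^sub>0\<close> of order \<open>n/t\<close>. Comparing the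
  lengths of the short relations modulo \<open>m\<close> shows that \<open>h\<close> is \<open>t e\<close> or \<open>t g\<close>, which excludes a third
  generator, and that \<open>t\<close> divides \<open>q\<close> and \<open>r\<close> unless \<open>t e = t g\<close>. An atom then has norm 1 with
  respect to \<open>e\<close> or to \<open>g\<close>, and the two norms differ by \<open>k (r y - q x) / n\<close>, where \<open>x\<close> and \<open>y\<close> are the
  multiplicities of \<open>e\<close> and \<open>g\<close>. Hence \<open>gcd k w\<close> divides \<open>m\<close>, where \<open>w = k r / gcd n (k r)\<close>, and
  every \<open>m\<close> with \<open>gcd k w\<close> dividing \<open>m\<close> and \<open>m\<close> dividing \<open>k\<close> is of the required form.
\<close>

section \<open>Minimal solutions of a linear congruence\<close>

text \<open>If \<open>e\<close> generates a group of order \<open>n\<close> and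
  \<open>h = a e\<close> differs from \<open>e\<close>, these are the multiplicities of
  \<open>e\<close> and \<open>h\<close> in the atoms over \<open>{e, h}\<close>.\<close>

definition minimal_solution :: "nat \<Rightarrow> nat \<Rightarrow> nat \<Rightarrow> nat \<Rightarrow> bool" where
  "minimal_solution n a x y \<longleftrightarrow> (x, y) \<noteq> (0, 0) \<and> n dvd x + a * y \<and>
     (\<forall>x' y'. x' \<le> x \<longrightarrow> y' \<le> y \<longrightarrow> n dvd x' + a * y' \<longrightarrow> (x', y') = (0, 0) \<or> (x', y') = (x, y))"

text \<open>A solution below has value at most \<open>n\<close>, hence 0 or \<open>n\<close>; as
  \<open>a\<close> is positive, each value forces one pair.\<close>

lemma minimal_solution_if_sum_eq:
  assumes "x + a * y = n" "0 < n" "0 < a"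
  shows "minimal_solution n a x y"
  unfolding minimal_solution_def
proof (intro conjI allI impI)
  show "(x, y) \<noteq> (0, 0)" using assms by auto
  show "n dvd x + a * y" using assms by auto
  fix x' y' assume *: "x' \<le> x" "y' \<le> y" "n dvd x' + a * y'"
  have le: "a * y' \<le> a * y" using *(2) by simp
  consider "x' + a * y' = 0" | "x' + a * y' = n"
    using *(1,3) le assms(1) dvd_imp_le[of n "x' + a * y'"] by fastforce
  then show "(x', y') = (0, 0) \<or> (x', y') = (x, y)"
  proof cases
    case 1 then show ?thesis using assms by auto
  next
    case 2
    then have "x' = x" "a * y' = a * y" using *(1) le assms(1) by linarith+
    then show ?thesis using assms by auto
  qed
qed

text \<open>With \<open>q = n div a\<close> and \<open>r = n mod a\<close>, the solution \<open>(r, q)\<close> has norm 1 with respect to \<open>a\<close>. The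
  next vertex of the hull of the solutions has norm \<open>p + 1\<close>, which gives \<open>m r < a\<close>; then \<open>(r, q)\<close> has
  norm 1 with respect to \<open>a'\<close> too, and both equations determine the parameters.\<close>

lemma two_generator_structure:
  fixes n a a' m k :: nat
  assumes a: "2 \<le> a" "a < n" and a': "a' \<le> n" and inv: "a * a' = 1 + n * k" and m: "n \<le> m ^ 2"
    and norm: "\<And>x y. minimal_solution n a x y \<Longrightarrow> \<exists>j. x + a * y = n * (1 + m * j)"
    and norm': "\<And>x y. minimal_solution n a x y \<Longrightarrow> \<exists>j. a' * x + y = n * (1 + m * j)"
  obtains q r where "1 \<le> q" "1 \<le> r" "1 \<le> k" "m dvd k" "a = k * r + 1" "a' = k * q + 1"
    "n = q * r * k + q + r"
proof -
  define q where "q = n div a"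
  define r where "r = n mod a"
  have n: "n = q * a + r" by (simp add: q_def r_def)
  have ra: "r < a" using a by (simp add: r_def)
  have q1: "1 \<le> q" using a by (simp add: q_def div_greater_zero_iff Suc_le_eq)
  \<comment> \<open>If \<open>a\<close> divided \<open>n\<close>, it would divide
    \<open>a a' - n k = 1\<close>.\<close>
  have r1: "1 \<le> r"
  proof (rule ccontr)
    assume "\<not> 1 \<le> r"
    then have "a dvd n" using n by (simp add: not_less_eq_eq)
    then have "a dvd a * a' - n * k" by (intro dvd_diff_nat dvd_triv_left) (simp add: dvd_mult2)
    then show False using inv a by simp
  qed
  have qn: "q < n" using n mult_le_mono2[of 1 a q] a r1 by linarith
  have min1: "minimal_solution n a r q"
    using n a by (intro minimal_solution_if_sum_eq) (auto simp: mult.commute)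
  \<comment> \<open>\<open>p\<close> is maximal with \<open>p r < a\<close>. The next vertex
    \<open>(s, y)\<close> is \<open>(p + 1) (r, q) + (-a, 1)\<close>.\<close>
  define p where "p = (a - 1) div r"
  have p_le: "p * r \<le> a - 1" by (simp add: p_def)
  have p_gt: "a \<le> (p + 1) * r"
    using dividend_less_div_times[of r "a - 1"] r1 a by (simp add: p_def algebra_simps)
  have p1: "1 \<le> p" using ra r1 a by (simp add: p_def div_greater_zero_iff Suc_le_eq)
  define s where "s = (p + 1) * r - a"
  have s: "s + a = (p + 1) * r" using p_gt by (simp add: s_def)
  have s_r: "s < r" using s p_le a by (simp add: algebra_simps)
  define y where "y = (p + 1) * q + 1"
  have sy: "s + a * y = n * (p + 1)"
  proof -
    have "s + a * y = (s + a) + a * (p + 1) * q" by (simp add: y_def algebra_simps)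
    also have "\<dots> = (p + 1) * (q * a + r)" by (simp only: s) (simp add: algebra_simps)
    finally show ?thesis using n by simp
  qed
  have min2: "minimal_solution n a s y"
    unfolding minimal_solution_def
  proof (intro conjI allI impI)
    show "(s, y) \<noteq> (0, 0)" by (simp add: y_def)
    show "n dvd s + a * y" by (simp add: sy)
    fix x' y' assume *: "x' \<le> s" "y' \<le> y" "n dvd x' + a * y'"
    then obtain i where i: "x' + a * y' = n * i" by blast
    have le: "a * y' \<le> a * y" using *(2) by simp
    have "n * i \<le> n * (p + 1)" using i sy *(1) le by linarith
    then have ip: "i \<le> p + 1" using a unfolding mult_le_cancel1 by simp
    \<comment> \<open>Modulo \<open>a\<close>, \<open>n\<close> is \<open>r\<close>, so
      \<open>x'\<close> is congruent to \<open>i r\<close>. For \<open>1 \<le> i \<le> p\<close>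
      both are below \<open>a\<close>, so \<open>x' = i r \<ge> r > s\<close>.\<close>
    have "i = 0 \<or> i = p + 1"
    proof (rule ccontr)
      assume "\<not> (i = 0 \<or> i = p + 1)"
      then have i1: "1 \<le> i" "i \<le> p" using ip by auto
      then have "i * r < a" using mult_le_mono1[of i p r] p_le a by linarith
      moreover have "(x' + a * y') mod a = (i * r) mod a"
        unfolding i n by (simp add: algebra_simps mod_add_right_eq)
      moreover have "x' < a" using *(1) s_r ra by linarith
      ultimately have "x' = i * r" by simp
      then show False using *(1) s_r i1 r1
        by (metis le_trans mult_le_mono1 nat_mult_1 not_less)
    qed
    then show "(x', y') = (0, 0) \<or> (x', y') = (s, y)"
    proof
      assume "i = 0" then show ?thesis using i a by auto
    next
      assume "i = p + 1"
      then have "x' + a * y' = s + a * y" using i sy by simp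
      then have "x' = s" "a * y' = a * y" using *(1) le by linarith+
      then show ?thesis using a by auto
    qed
  qed
  obtain j where "s + a * y = n * (1 + m * j)" using norm[OF min2] by blast
  then have "n * (p + 1) = n * (m * j + 1)" using sy by simp
  then have pj: "p = m * j" using a by simp
  then have mp: "m dvd p" "m \<le> p" using p1 by (auto intro: dvd_imp_le)
  have mr: "m * r < a" using mult_le_mono1[OF mp(2), of r] p_le a by linarith
  obtain l where l: "a' * r + q = n * (1 + m * l)" using norm'[OF min1] by blast
  \<comment> \<open>Otherwise \<open>m < r\<close>, and \<open>m r < a\<close> gives
    \<open>m\<^sup>2 < a < n\<close>.\<close>
  have "l = 0"
  proof (rule ccontr)
    assume "l \<noteq> 0"
    then have "m \<le> m * l" by simp
    then have "n * (1 + m) \<le> a' * r + q" unfolding l by simp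
    then have "n * m < a' * r" using qn by simp
    then have "n * m < n * r" using mult_le_mono1[OF a', of r] by linarith
    then have "m < r" using a by simp
    then have "m * m < a" using mult_le_mono2[of m r m] mr by linarith
    then show False using a m by (simp add: power2_eq_square)
  qed
  then have a'r: "a' * r + q = n" using l by simp
  have aq: "a * q + r = n" using n by simp
  have "q * r * k + q + r = n"
  proof -
    \<comment> \<open>Multiply \<open>a q = n - r\<close> by \<open>a' r = n - q\<close>, insert
      \<open>a a' = 1 + n k\<close>, and cancel \<open>n\<close>.\<close>
    have "int (a * q) * int (a' * r) = (int n - int r) * (int n - int q)"
      using a'r aq by (metis (no_types) add_diff_cancel_right' of_nat_add)
    moreover have "int (a * q) * int (a' * r) = int (q * r) * (1 + int n * int k)"
      using inv by (metis (no_types, opaque_lifting) mult.commute mult.left_commute of_nat_1 of_nat_add of_nat_mult mult.assoc)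
    ultimately have "int n * (int (q * r * k + q + r)) = int n * int n"
      by (simp add: algebra_simps)
    then have "int (q * r * k + q + r) = int n" using a by simp
    then show ?thesis using of_nat_eq_iff by blast
  qed
  note nk = this
  have "a * q = (k * r + 1) * q" using aq nk by (simp add: algebra_simps)
  then have ak: "a = k * r + 1" using q1 unfolding mult_cancel2 by simp
  have "a' * r = (k * q + 1) * r" using a'r nk by (simp add: algebra_simps)
  then have a'k: "a' = k * q + 1" using r1 unfolding mult_cancel2 by simp
  have "k \<ge> 1" using ak a by (cases k) auto
  \<comment> \<open>\<open>a - 1 = k r\<close>, so the divisibility of \<open>p\<close> by
    \<open>m\<close> passes to \<open>k\<close>.\<close>
  moreover have "p = k" using ak r1 by (simp add: p_def)
  ultimately show ?thesis using that q1 r1 mp ak a'k nk by simp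
qed

section \<open>Numerical consequences of the cube bound\<close>

lemma le_power2_of_cube:
  fixes m n :: nat
  assumes "2 * n ^ 2 \<le> m ^ 3"
  shows "n \<le> m ^ 2"
proof (rule ccontr)
  assume "\<not> n \<le> m ^ 2"
  then have lt: "m ^ 2 < n" by simp
  then have "(m ^ 2) ^ 2 < n ^ 2" by (intro power_strict_mono) auto
  then have "2 * m ^ 4 < m ^ 3" using assms by simp
  moreover have "m ^ 3 \<le> m ^ 4" by (cases "m = 0") (auto intro: power_increasing)
  ultimately show False by linarith
qed

text \<open>Otherwise \<open>q + r \<le> 2 q r\<close> gives \<open>m (m + 2) \<le> 2 n\<close>, too
  large for the cube bound. When \<open>m\<close> divides \<open>k\<close>, this makes
  \<open>t (q + r)\<close> the residue of \<open>n\<close> modulo \<open>m\<close>.\<close>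

lemma sum_lt_of_cube:
  fixes n m q r k t :: nat
  assumes n: "n = t * (q * r * k + q + r)" and m: "2 * n ^ 2 \<le> m ^ 3"
    and "1 \<le> t" "1 \<le> q" "1 \<le> r" "m \<le> k"
  shows "t * (q + r) < m"
proof (rule ccontr)
  assume "\<not> t * (q + r) < m"
  then have ge: "m \<le> t * (q + r)" by simp
  obtain q' r' where qr: "q = Suc q'" "r = Suc r'" using assms by (metis Suc_le_D One_nat_def)
  have "q + r \<le> 2 * (q * r)" unfolding qr by (simp add: algebra_simps)
  then have "(q + r) * m \<le> 2 * (q * r) * k" using \<open>m \<le> k\<close> by (intro mult_le_mono)
  then have "(q + r) * (m + 2) \<le> 2 * (q * r * k + q + r)" by (simp add: algebra_simps)
  then have "t * ((q + r) * (m + 2)) \<le> t * (2 * (q * r * k + q + r))" by (rule mult_le_mono2)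
  then have "t * (q + r) * (m + 2) \<le> 2 * n" unfolding n by (simp add: algebra_simps)
  moreover have "m * (m + 2) \<le> t * (q + r) * (m + 2)" using ge by (rule mult_le_mono1)
  ultimately have "m * (m + 2) \<le> 2 * n" by linarith
  then have "(m * (m + 2)) ^ 2 \<le> (2 * n) ^ 2" by (rule power_mono) simp
  then have "m ^ 2 * (m + 2) ^ 2 \<le> 2 * m ^ 3" using m unfolding power_mult_distrib by (simp del: add_2_eq_Suc')
  then have "m ^ 2 * (m + 2) ^ 2 \<le> m ^ 2 * (2 * m)" by (simp add: power3_eq_cube power2_eq_square algebra_simps)
  moreover have "0 < m"
  proof (rule ccontr)
    assume "\<not> 0 < m"
    then have "n = 0" using m by simp
    then show False using n assms by simp
  qed
  ultimately have "(m + 2) ^ 2 \<le> 2 * m" by simp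
  then show False by (simp add: power2_eq_square algebra_simps)
qed

text \<open>The left side will bound the number of distinct terms of an atom. If it exceeded
  \<open>m\<close>, then \<open>n\<close> would be at least \<open>m (m - 2) + m - 1\<close>, of
  order \<open>m\<^sup>2\<close>.\<close>

lemma sum_add_2_le_of_cube:
  fixes n m q r k :: nat
  assumes n: "n = q * r * k + q + r" and m: "2 * n ^ 2 \<le> m ^ 3"
    and "1 \<le> q" "1 \<le> r" "m \<le> k"
  shows "q + r + 2 \<le> m"
proof (rule ccontr)
  assume "\<not> q + r + 2 \<le> m"
  then have lt: "m \<le> q + r + 1" by simp
  obtain q' r' where qr: "q = Suc q'" "r = Suc r'" using assms by (metis Suc_le_D One_nat_def)
  have *: "(q' + r' + 1) * m \<le> q * r * k" unfolding qr using \<open>m \<le> k\<close> by (intro mult_le_mono) simp_all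
  then have n1: "(q' + r' + 1) * m + q' + r' + 2 \<le> n" using n qr by simp
  then have "m + 2 \<le> n" by (simp add: algebra_simps)
  then have "(m + 2) ^ 2 \<le> n ^ 2" by (rule power_mono) simp
  then have c: "2 * (m + 2) ^ 2 \<le> m ^ 3" using m by linarith
  \<comment> \<open>The weaker bound \<open>n \<ge> m + 2\<close> disposes of small
    \<open>m\<close>; with \<open>m = u + 5\<close> the final inequality fails coefficient by
    coefficient.\<close>
  have m5: "5 \<le> m"
  proof (rule ccontr)
    assume "\<not> 5 \<le> m"
    then have "m \<in> {0,1,2,3,4}" by auto
    then show False using c by (elim insertE) (simp_all add: power2_eq_square)
  qed
  then obtain u where u: "m = u + 5" by (metis le_Suc_ex add.commute)
  have "(u + 3) * (u + 5) + u + 4 \<le> (q' + r' + 1) * m + q' + r' + 2"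
  proof -
    have "u + 3 \<le> q' + r' + 1 + 0" using lt u qr by simp
    then show ?thesis unfolding u using mult_le_mono1[of "u+3" "q'+r'+1" "u+5"] by linarith
  qed
  then have "(u + 3) * (u + 5) + u + 4 \<le> n" using n1 by linarith
  then have "((u + 3) * (u + 5) + u + 4) ^ 2 \<le> n ^ 2" by (rule power_mono) simp
  then have "2 * ((u + 3) * (u + 5) + u + 4) ^ 2 \<le> (u + 5) ^ 3" using m unfolding u by linarith
  then show False by (simp add: power2_eq_square power3_eq_cube algebra_simps)
qed

section \<open>Factorization lengths\<close>

lemma minimal_zero_sum_seqsD:
  assumes "A \<in> minimal_zero_sum_seqs G\<^sub>0"
  shows "set_mset A \<subseteq> G\<^sub>0" "\<Sum>\<^sub># A = 0" "A \<noteq> {#}"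
    "\<And>T. T \<subseteq># A \<Longrightarrow> T \<noteq> {#} \<Longrightarrow> \<Sum>\<^sub># T = 0 \<Longrightarrow> T = A"
  using assms unfolding minimal_zero_sum_seqs_def zero_sum_seqs_def
  by (auto simp: subset_mset.less_le)

lemma minimal_zero_sum_seqsI:
  assumes "set_mset A \<subseteq> G\<^sub>0" "\<Sum>\<^sub># A = 0" "A \<noteq> {#}"
    "\<And>T. T \<subseteq># A \<Longrightarrow> T \<noteq> {#} \<Longrightarrow> \<Sum>\<^sub># T = 0 \<Longrightarrow> T = A"
  shows "A \<in> minimal_zero_sum_seqs G\<^sub>0"
  using assms unfolding minimal_zero_sum_seqs_def zero_sum_seqs_def
  by (auto simp: subset_mset.less_le)

lemma ex_factorization:
  assumes "B \<in> zero_sum_seqs G\<^sub>0"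
  shows "\<exists>F. set_mset F \<subseteq> minimal_zero_sum_seqs G\<^sub>0 \<and> \<Sum>\<^sub># F = B"
  using assms
proof (induction "size B" arbitrary: B rule: less_induct)
  case less
  show ?case
  proof (cases "B = {#} \<or> B \<in> minimal_zero_sum_seqs G\<^sub>0")
    case True
    then show ?thesis
    proof
      assume "B = {#}" then show ?thesis by (intro exI[of _ "{#}"]) simp
    next
      assume "B \<in> minimal_zero_sum_seqs G\<^sub>0" then show ?thesis by (intro exI[of _ "{#B#}"]) simp
    qed
  next
    case False
    then obtain T where T: "T \<subset># B" "T \<noteq> {#}" "\<Sum>\<^sub># T = 0"
      using less.prems unfolding minimal_zero_sum_seqs_def by auto
    then obtain U where U: "B = T + U" by (metis mset_subset_eq_exists_conv subset_mset.less_imp_le)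
    have "T \<in> zero_sum_seqs G\<^sub>0" "U \<in> zero_sum_seqs G\<^sub>0"
      using less.prems T U by (auto simp: zero_sum_seqs_def)
    moreover have "size T < size B" "size U < size B"
      using T U by (auto simp flip: nonempty_has_size)
    ultimately obtain F F' where "set_mset F \<subseteq> minimal_zero_sum_seqs G\<^sub>0" "\<Sum>\<^sub># F = T"
      "set_mset F' \<subseteq> minimal_zero_sum_seqs G\<^sub>0" "\<Sum>\<^sub># F' = U"
      using less.hyps by meson
    then show ?thesis using U by (intro exI[of _ "F + F'"]) auto
  qed
qed

text \<open>The element following \<open>l\<close> gives a distance; hence any positive difference
  of two lengths bounds the minimal distance from above.\<close>

lemma ex_successive_distance_le:
  assumes "l \<in> L" "l' \<in> L" "l < l'"
  shows "\<exists>d\<in>successive_distances L. d \<le> l' - l"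
proof -
  define l'' where "l'' = (LEAST x. x \<in> L \<and> l < x)"
  have *: "l'' \<in> L \<and> l < l''" unfolding l''_def by (rule LeastI[of _ l']) (use assms in auto)
  have "l'' \<le> l'" unfolding l''_def by (rule Least_le) (use assms in auto)
  moreover have "\<not> (\<exists>x\<in>L. l < x \<and> x < l'')" unfolding l''_def using not_less_Least by blast
  ultimately show ?thesis using * assms(1) unfolding successive_distances_def by force
qed

lemma zero_sum_seqs_sum:
  assumes "set_mset F \<subseteq> minimal_zero_sum_seqs G\<^sub>0"
  shows "\<Sum>\<^sub># F \<in> zero_sum_seqs G\<^sub>0"
  using assms
  by (induction F) (auto simp: zero_sum_seqs_def dest: minimal_zero_sum_seqsD(1,2))

lemma min_distance_le_diff:
  assumes "set_mset F \<subseteq> minimal_zero_sum_seqs G\<^sub>0" "set_mset F' \<subseteq> minimal_zero_sum_seqs G\<^sub>0"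
    "\<Sum>\<^sub># F = \<Sum>\<^sub># F'" "size F < size F'"
  shows "min_distance G\<^sub>0 \<le> size F' - size F"
proof -
  let ?L = "length_set G\<^sub>0 (\<Sum>\<^sub># F)"
  have "size F \<in> ?L" "size F' \<in> ?L" using assms unfolding length_set_def by auto
  then obtain d where d: "d \<in> successive_distances ?L" "d \<le> size F' - size F"
    using ex_successive_distance_le assms(4) by blast
  then have "d \<in> set_of_distances G\<^sub>0"
    unfolding set_of_distances_def using zero_sum_seqs_sum[OF assms(1)] by auto
  then have "min_distance G\<^sub>0 \<le> d" unfolding min_distance_def by (auto intro: Least_le)
  then show ?thesis using d by linarith
qed

lemma min_distance_attained:
  assumes "0 < min_distance G\<^sub>0"
  obtains F F' where "set_mset F \<subseteq> minimal_zero_sum_seqs G\<^sub>0" "set_mset F' \<subseteq> minimal_zero_sum_seqs G\<^sub>0"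
    "\<Sum>\<^sub># F = \<Sum>\<^sub># F'" "size F' = size F + min_distance G\<^sub>0"
proof -
  have ne: "set_of_distances G\<^sub>0 \<noteq> {}" using assms by (auto simp: min_distance_def)
  then have "min_distance G\<^sub>0 \<in> set_of_distances G\<^sub>0"
    unfolding min_distance_def by (auto intro: LeastI)
  then obtain B l l' where *: "min_distance G\<^sub>0 = l' - l" "l \<in> length_set G\<^sub>0 B" "l' \<in> length_set G\<^sub>0 B" "l < l'"
    unfolding set_of_distances_def successive_distances_def by blast
  then show ?thesis using that unfolding length_set_def by (smt (verit) le_add_diff_inverse less_imp_le mem_Collect_eq)
qed

text \<open>The differences of factorization lengths form a subgroup of the integers, so its least
  positive element divides all of them.\<close>

lemma min_distance_dvd_diff:
  assumes F: "set_mset F \<subseteq> minimal_zero_sum_seqs G\<^sub>0" "set_mset F' \<subseteq> minimal_zero_sum_seqs G\<^sub>0"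
    "\<Sum>\<^sub># F = \<Sum>\<^sub># F'" "size F' = size F + x" and pos: "0 < min_distance G\<^sub>0"
  shows "min_distance G\<^sub>0 dvd x"
proof (rule ccontr)
  let ?m = "min_distance G\<^sub>0"
  assume "\<not> ?m dvd x"
  then have mod: "0 < x mod ?m" by (simp add: mod_greater_zero_iff_not_dvd)
  obtain E E' where E: "set_mset E \<subseteq> minimal_zero_sum_seqs G\<^sub>0" "set_mset E' \<subseteq> minimal_zero_sum_seqs G\<^sub>0"
    "\<Sum>\<^sub># E = \<Sum>\<^sub># E'" "size E' = size E + ?m"
    using min_distance_attained[OF pos] .
  define c where "c = x div ?m"
  have x: "x = c * ?m + x mod ?m" by (simp add: c_def)
  \<comment> \<open>Subtracting the attained relation \<open>c\<close> times from the given one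
    leaves the length difference \<open>x mod ?m\<close>.\<close>
  define H where "H = F + repeat_mset c E'"
  define H' where "H' = F' + repeat_mset c E"
  have sum_rep: "\<Sum>\<^sub># (repeat_mset c X) = repeat_mset c (\<Sum>\<^sub># X)" for X :: "'a multiset multiset"
    by (induction c) auto
  have "set_mset (repeat_mset c X) \<subseteq> set_mset X" for X :: "'a multiset multiset"
    by (induction c) auto
  note set_rep = this[THEN subsetD]
  have "size H' = size H + x mod ?m" using F(4) E(4) x by (simp add: H_def H'_def algebra_simps)
  moreover have "set_mset H \<subseteq> minimal_zero_sum_seqs G\<^sub>0" "set_mset H' \<subseteq> minimal_zero_sum_seqs G\<^sub>0"
    using F E by (auto simp: H_def H'_def dest!: set_rep)
  moreover have "\<Sum>\<^sub># H = \<Sum>\<^sub># H'" using F(3) E(3) by (simp add: H_def H'_def sum_rep)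
  ultimately have "?m \<le> x mod ?m" using min_distance_le_diff[of H G\<^sub>0 H'] mod by simp
  then show False using pos by (meson mod_less_divisor not_less)
qed

lemma min_distance_dvd_int_diff:
  assumes "set_mset F \<subseteq> minimal_zero_sum_seqs G\<^sub>0" "set_mset F' \<subseteq> minimal_zero_sum_seqs G\<^sub>0"
    "\<Sum>\<^sub># F = \<Sum>\<^sub># F'" and pos: "0 < min_distance G\<^sub>0"
  shows "int (min_distance G\<^sub>0) dvd int (size F') - int (size F)"
proof (cases "size F \<le> size F'")
  case True
  then obtain x where "size F' = size F + x" using le_Suc_ex by blast
  then show ?thesis using min_distance_dvd_diff[of F G\<^sub>0 F' x] assms by simp
next
  case False
  then obtain x where "size F = size F' + x" using le_Suc_ex by (metis nat_le_linear)
  then show ?thesis using min_distance_dvd_diff[of F' G\<^sub>0 F x] assms by simp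
qed

text \<open>An additive weight determines \<open>c\<close> times the length of a factorization
  modulo \<open>c * \<delta>\<close>; compare the two sides of a relation attaining the minimum.
  Later \<open>c\<close> is the group order and \<open>w\<close> is \<open>sigma e\<close>.\<close>

lemma dvd_min_distance:
  fixes w :: "'a::ab_group_add \<Rightarrow> int"
  assumes w: "\<And>A. A \<in> minimal_zero_sum_seqs G\<^sub>0 \<Longrightarrow> c * \<delta> dvd (\<Sum>h\<in>#A. w h) - c"
    and c: "c \<noteq> 0" and pos: "0 < min_distance G\<^sub>0"
  shows "\<delta> dvd int (min_distance G\<^sub>0)"
proof -
  have *: "c * \<delta> dvd (\<Sum>h\<in>#\<Sum>\<^sub># F. w h) - c * int (size F)"
    if "set_mset F \<subseteq> minimal_zero_sum_seqs G\<^sub>0" for F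
    using that
  proof (induction F)
    case (add A F)
    then have "c * \<delta> dvd ((\<Sum>h\<in>#A. w h) - c) + ((\<Sum>h\<in>#\<Sum>\<^sub># F. w h) - c * int (size F))"
      using w by (intro dvd_add) auto
    then show ?case by (simp add: algebra_simps)
  qed simp
  obtain F F' where F: "set_mset F \<subseteq> minimal_zero_sum_seqs G\<^sub>0" "set_mset F' \<subseteq> minimal_zero_sum_seqs G\<^sub>0"
    "\<Sum>\<^sub># F = \<Sum>\<^sub># F'" "size F' = size F + min_distance G\<^sub>0"
    using min_distance_attained[OF pos] .
  have "c * \<delta> dvd ((\<Sum>h\<in>#\<Sum>\<^sub># F. w h) - c * int (size F)) - ((\<Sum>h\<in>#\<Sum>\<^sub># F'. w h) - c * int (size F'))"
    by (intro dvd_diff * F)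
  then have "c * \<delta> dvd c * int (min_distance G\<^sub>0)" using F by (simp add: algebra_simps)
  then show ?thesis using c by simp
qed

section \<open>Generators and norms\<close>

lemma iterate_add_mult: "iterate_add (i * j) a = iterate_add i (iterate_add j a)"
  by (induction i) auto

lemma replicate_mset_add: "replicate_mset (i + j) x = replicate_mset i x + replicate_mset j x"
  by (rule multiset_eqI) simp

lemma sum_mset_replicate: "\<Sum>\<^sub># (replicate_mset i a) = iterate_add i (a :: 'a :: ab_group_add)"
  by (induction i) auto

text \<open>Translation by \<open>h\<close> permutes the group, so the sum of all elements is
  unchanged when \<open>h\<close> is added once per element.\<close>

lemma iterate_add_card: "iterate_add (CARD('a)) (h :: 'a :: {finite, ab_group_add}) = 0"
proof -
  have const: "(\<Sum>x\<in>S. h) = iterate_add (card S) h" if "finite S" for S :: "'a set"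
    using that by (induction S) auto
  have "(\<Sum>x\<in>UNIV. x) = (\<Sum>x\<in>UNIV. x + h)"
    by (rule sum.reindex_bij_witness[where i = "\<lambda>x. x + h" and j = "\<lambda>x. x - h"]) auto
  also have "\<dots> = (\<Sum>x\<in>UNIV. x) + iterate_add (CARD('a)) h"
    by (simp add: sum.distrib const)
  finally show ?thesis by simp
qed

lemma iterate_add_mod: "iterate_add (i mod CARD('a)) (h :: 'a :: {finite, ab_group_add}) = iterate_add i h"
proof -
  have "iterate_add i h = iterate_add (i div CARD('a) * CARD('a) + i mod CARD('a)) h" by simp
  then show ?thesis unfolding iterate_add_distrib iterate_add_mult iterate_add_card by simp
qed

context
  fixes e :: "'a :: {finite, ab_group_add}"
  assumes gen: "generating e"
begin

lemma iterate_add_image: "(\<lambda>i. iterate_add i e) ` {..<CARD('a)} = UNIV"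
proof -
  let ?R = "(\<lambda>i. iterate_add i e) ` {..<CARD('a)}"
  have R: "iterate_add i e \<in> ?R" for i
    using iterate_add_mod[of i e] by (metis image_eqI lessThan_iff mod_less_divisor zero_less_card_finite)
  have "s \<in> ?R" if "s \<in> group_closure {e}" for s
    using that
  proof induction
    case (base s)
    then show ?case using R[of 0] R[of 1] by auto
  next
    case (diff s t)
    then obtain i j where ij: "s = iterate_add i e" "t = iterate_add j e" by blast
    \<comment> \<open>\<open>CARD('a) - 1\<close> copies of an element represent its negative as a
      natural multiple.\<close>
    have "iterate_add (j * (CARD('a) - 1)) e + iterate_add j e = iterate_add (j * CARD('a)) e"
      by (simp flip: iterate_add_distrib add: algebra_simps)
    also have "\<dots> = 0" unfolding iterate_add_mult iterate_add_card by simp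
    finally have "iterate_add (j * (CARD('a) - 1)) e = - t"
      unfolding ij by (simp only: eq_neg_iff_add_eq_0)
    then have "s - t = iterate_add (i + j * (CARD('a) - 1)) e"
      by (simp only: ij(1) iterate_add_distrib diff_conv_add_uminus)
    then show ?case using R by metis
  qed
  then show ?thesis using gen unfolding generating_def by auto
qed

lemma iterate_add_inj: "inj_on (\<lambda>i. iterate_add i e) {..<CARD('a)}"
  by (rule eq_card_imp_inj_on) (simp_all add: iterate_add_image)

lemma iterate_add_eq_iff: "iterate_add i e = iterate_add j e \<longleftrightarrow> i mod CARD('a) = j mod CARD('a)"
proof
  assume "iterate_add i e = iterate_add j e"
  then have "iterate_add (i mod CARD('a)) e = iterate_add (j mod CARD('a)) e"
    by (simp add: iterate_add_mod)
  then show "i mod CARD('a) = j mod CARD('a)"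
    by (intro inj_onD[OF iterate_add_inj]) auto
next
  assume "i mod CARD('a) = j mod CARD('a)"
  then show "iterate_add i e = iterate_add j e" by (metis iterate_add_mod)
qed

lemma iterate_add_eq_0_iff: "iterate_add i e = 0 \<longleftrightarrow> CARD('a) dvd i"
  using iterate_add_eq_iff[of i 0] by (simp add: dvd_eq_mod_eq_0)

lemma sigma_eqI:
  assumes "h = iterate_add i e" "1 \<le> i" "i \<le> CARD('a)"
  shows "sigma e h = i"
  unfolding sigma_def
proof (rule the_equality)
  show "i \<in> {1..CARD('a)} \<and> h = iterate_add i e" using assms by simp
  fix j assume "j \<in> {1..CARD('a)} \<and> h = iterate_add j e"
  then have j: "1 \<le> j" "j \<le> CARD('a)" "j mod CARD('a) = i mod CARD('a)"
    using assms iterate_add_eq_iff by auto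
  \<comment> \<open>In \<open>{1..n}\<close> only \<open>n\<close> itself has residue 0, hence the
    separate cases.\<close>
  then show "j = i" using assms by (cases "j = CARD('a)"; cases "i = CARD('a)") auto
qed

lemma sigma: "1 \<le> sigma e h" "sigma e h \<le> CARD('a)" "iterate_add (sigma e h) e = h"
proof -
  obtain i where i: "i < CARD('a)" "h = iterate_add i e" using iterate_add_image by blast
  have "1 \<le> sigma e h \<and> sigma e h \<le> CARD('a) \<and> iterate_add (sigma e h) e = h"
  proof (cases "i = 0")
    case True
    then have "sigma e h = CARD('a)"
      using i iterate_add_card[of e] by (intro sigma_eqI) (auto simp: Suc_le_eq)
    then show ?thesis using iterate_add_card[of e] i True by (auto simp: Suc_le_eq)
  next
    case False
    then have "sigma e h = i" using i by (intro sigma_eqI) auto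
    then show ?thesis using i False by auto
  qed
  then show "1 \<le> sigma e h" "sigma e h \<le> CARD('a)" "iterate_add (sigma e h) e = h" by auto
qed

lemma sigma_self: "sigma e e = 1"
  by (rule sigma_eqI) (auto simp: Suc_le_eq)

end

text \<open>The norm multiplied by the group order.\<close>

definition weight :: "'a::{finite, ab_group_add} \<Rightarrow> 'a multiset \<Rightarrow> nat" where
  "weight e A = (\<Sum>h\<in>#A. sigma e h)"

lemma weight_simps [simp]:
  "weight e {#} = 0" "weight e (A + B) = weight e A + weight e B"
  "weight e (add_mset h A) = sigma e h + weight e A"
  "weight e (replicate_mset i h) = i * sigma e h"
  by (simp_all add: weight_def)

context
  fixes e :: "'a :: {finite, ab_group_add}"
  assumes gen: "generating e"
begin

lemma sum_mset_eq_iterate_weight: "\<Sum>\<^sub># A = iterate_add (weight e A) e"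
  by (induction A) (simp_all add: sigma(3)[OF gen])

lemma sum_mset_eq_0_iff: "\<Sum>\<^sub># A = 0 \<longleftrightarrow> CARD('a) dvd weight e A"
  using sum_mset_eq_iterate_weight iterate_add_eq_0_iff[OF gen] by metis

lemma weight_pos: "A \<noteq> {#} \<Longrightarrow> 0 < weight e A"
  using sigma(1)[OF gen] by (induction A) (auto simp: Suc_le_eq)

text \<open>A nonempty zero-sum part already has weight at least the group order, so the remainder
  has weight 0 and is empty.\<close>

lemma minimal_if_weight_eq_card:
  assumes "set_mset A \<subseteq> G\<^sub>0" "weight e A = CARD('a)"
  shows "A \<in> minimal_zero_sum_seqs G\<^sub>0"
proof (rule minimal_zero_sum_seqsI)
  show "\<Sum>\<^sub># A = 0" using assms by (simp add: sum_mset_eq_0_iff)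
  show "A \<noteq> {#}" using assms by auto
  fix T assume T: "T \<subseteq># A" "T \<noteq> {#}" "\<Sum>\<^sub># T = 0"
  then obtain U where U: "A = T + U" by (metis mset_subset_eq_exists_conv)
  have "CARD('a) \<le> weight e T" using T weight_pos by (simp add: sum_mset_eq_0_iff dvd_imp_le)
  then have "weight e U = 0" using U assms by simp
  then have "U = {#}" using weight_pos[of U] by auto
  then show "T = A" using U by simp
qed fact

text \<open>Let \<open>E\<close> consist of \<open>n\<close> copies of \<open>e\<close>, and let
  \<open>P h\<close> be \<open>h\<close> filled up with copies of \<open>e\<close> to norm 1. If
  \<open>A\<close> has norm \<open>N\<close>, then \<open>A\<close> with \<open>size A\<close>
  copies of \<open>E\<close> equals the product of all \<open>P h\<close> with \<open>N\<close>
  copies of \<open>E\<close>; the lengths differ by \<open>N - 1\<close>.\<close>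

lemma weight_minimal:
  assumes e: "e \<in> G\<^sub>0" and pos: "0 < min_distance G\<^sub>0" and A: "A \<in> minimal_zero_sum_seqs G\<^sub>0"
  obtains j where "weight e A = CARD('a) * (1 + min_distance G\<^sub>0 * j)"
proof -
  let ?n = "CARD('a)"
  let ?m = "min_distance G\<^sub>0"
  obtain N where N: "weight e A = ?n * N"
    using minimal_zero_sum_seqsD(2)[OF A] by (auto simp: sum_mset_eq_0_iff)
  have "N \<noteq> 0" using N weight_pos[OF minimal_zero_sum_seqsD(3)[OF A]] by auto
  define E where "E = replicate_mset ?n e"
  define P where "P h = {#h#} + replicate_mset (?n - sigma e h) e" for h
  have E: "E \<in> minimal_zero_sum_seqs G\<^sub>0"
    unfolding E_def using e by (intro minimal_if_weight_eq_card) (auto simp: sigma_self[OF gen])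
  have P: "P h \<in> minimal_zero_sum_seqs G\<^sub>0" if "h \<in># A" for h
    unfolding P_def using e that minimal_zero_sum_seqsD(1)[OF A] sigma[OF gen, of h]
    by (intro minimal_if_weight_eq_card) (auto simp: sigma_self[OF gen] split: if_splits)
  have sumE: "\<Sum>\<^sub># (replicate_mset i E) = replicate_mset (i * ?n) e" for i
    by (induction i) (simp_all add: E_def replicate_mset_add)
  \<comment> \<open>The \<open>weight e B\<close> missing copies of \<open>e\<close> are added on
    the left, so that the identity needs no subtraction.\<close>
  have sumP: "\<Sum>\<^sub># (image_mset P B) + replicate_mset (weight e B) e = B + replicate_mset (size B * ?n) e" for B
  proof (induction B)
    case (add h B)
    show ?case
    proof (rule multiset_eqI)
      fix x
      show "count (\<Sum>\<^sub># (image_mset P (add_mset h B)) + replicate_mset (weight e (add_mset h B)) e) x =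
          count (add_mset h B + replicate_mset (size (add_mset h B) * ?n) e) x"
        using arg_cong[OF add.IH, of "\<lambda>M. count M x"] sigma(2)[OF gen, of h]
        by (cases "x = e"; cases "x = h") (auto simp: P_def[of h] P_def[of e])
    qed
  qed simp
  define F where "F = {#A#} + replicate_mset (size A) E"
  define F' where "F' = image_mset P A + replicate_mset N E"
  have "int ?m dvd int (size F') - int (size F)"
  proof (rule min_distance_dvd_int_diff[OF _ _ _ pos])
    show "set_mset F \<subseteq> minimal_zero_sum_seqs G\<^sub>0" using A E by (auto simp: F_def split: if_splits)
    show "set_mset F' \<subseteq> minimal_zero_sum_seqs G\<^sub>0" using P E by (auto simp: F'_def split: if_splits)
    show "\<Sum>\<^sub># F = \<Sum>\<^sub># F'" using sumP[of A] N by (simp add: F_def F'_def sumE mult.commute)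
  qed
  then have "int ?m dvd int (N - 1)" using \<open>N \<noteq> 0\<close> by (simp add: F_def F'_def of_nat_diff)
  then have "?m dvd N - 1" by simp
  then obtain j where "N - 1 = ?m * j" ..
  then show ?thesis using that N \<open>N \<noteq> 0\<close> by (metis Suc_pred' neq0_conv plus_1_eq_Suc)
qed

end

section \<open>Structure of pairs\<close>

lemma two_element_mset:
  assumes "set_mset T \<subseteq> {e, h}" "e \<noteq> h"
  shows "\<exists>i j. T = replicate_mset i e + replicate_mset j h"
proof (intro exI multiset_eqI)
  fix x
  show "count T x = count (replicate_mset (count T e) e + replicate_mset (count T h) h) x"
    using assms by (cases "x \<in># T") (auto simp: not_in_iff)
qed

text \<open>The lower bound on the minimal distance, cubed to stay within the naturals.\<close>

locale large_min_distance =
  fixes G\<^sub>0 :: "'a::{finite, ab_group_add} set"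
  assumes cube: "2 * CARD('a) ^ 2 \<le> min_distance G\<^sub>0 ^ 3"
begin

abbreviation m where "m \<equiv> min_distance G\<^sub>0"
abbreviation atoms where "atoms \<equiv> minimal_zero_sum_seqs G\<^sub>0"

lemma pos: "0 < m"
  using cube by (cases m) auto

text \<open>As \<open>t\<close> divides both \<open>sigma e h\<close> and the order, a zero-sum
  sequence over \<open>{e, h}\<close> contains \<open>e\<close> a multiple of \<open>t\<close>
  times; dividing by \<open>t\<close> gives the congruence modulo \<open>\<nu>\<close>.\<close>

lemma minimal_if_minimal_solution:
  assumes e: "generating e" "e \<in> G\<^sub>0" and h: "h \<in> G\<^sub>0" "e \<noteq> h"
    and t: "1 \<le> t" and b: "sigma e h = t * b" and n: "CARD('a) = t * \<nu>"
    and xy: "minimal_solution \<nu> b x y"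
  shows "replicate_mset (t * x) e + replicate_mset y h \<in> atoms"
proof (rule minimal_zero_sum_seqsI)
  let ?A = "replicate_mset (t * x) e + replicate_mset y h"
  have weight: "weight e (replicate_mset i e + replicate_mset j h) = i + t * b * j" for i j
    using b by (simp add: sigma_self[OF e(1)] mult.commute)
  show "set_mset ?A \<subseteq> G\<^sub>0" using e h by (auto split: if_splits)
  have "weight e ?A = t * (x + b * y)" unfolding weight by (simp add: algebra_simps)
  moreover have "CARD('a) dvd t * (x + b * y)"
    using xy unfolding n minimal_solution_def by (intro mult_dvd_mono) auto
  ultimately show "\<Sum>\<^sub># ?A = 0" by (simp only: sum_mset_eq_0_iff[OF e(1)])
  show "?A \<noteq> {#}" using xy t by (auto simp: minimal_solution_def)
  fix T assume T: "T \<subseteq># ?A" "T \<noteq> {#}" "\<Sum>\<^sub># T = 0"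
  have "set_mset T \<subseteq> {e, h}" using set_mset_mono[OF T(1)] by (auto split: if_splits)
  then obtain i j where T_eq: "T = replicate_mset i e + replicate_mset j h"
    using two_element_mset[OF _ h(2)] by blast
  have i_le: "i \<le> t * x" and j_le: "j \<le> y"
    using mset_subset_eq_count[OF T(1), of e] mset_subset_eq_count[OF T(1), of h] h(2)
    unfolding T_eq by simp_all
  have "CARD('a) dvd weight e T" using T(3) by (simp only: sum_mset_eq_0_iff[OF e(1)])
  then have dvd: "t * \<nu> dvd i + t * (b * j)" unfolding T_eq weight n by (simp only: mult.assoc)
  then have "t dvd i" by (metis dvd_add_left_iff dvd_mult_left dvd_triv_left)
  then obtain x' where x': "i = t * x'" by blast
  have "t * \<nu> dvd t * (x' + b * j)" using dvd unfolding x' add_mult_distrib2 .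
  then have "\<nu> dvd x' + b * j" using t by simp
  moreover have "x' \<le> x" using i_le t unfolding x' by simp
  ultimately have "(x', j) = (0, 0) \<or> (x', j) = (x, y)"
    using xy j_le unfolding minimal_solution_def by blast
  then show "T = ?A" using T(2) unfolding T_eq x' by auto
qed

text \<open>The norm of \<open>A\<close> with respect to \<open>h\<close> instead of \<open>e\<close>: here \<open>h\<close> need not generate the group,
  but \<open>t e\<close> and \<open>h\<close> generate the same subgroup, of order \<open>\<nu>\<close>.\<close>

lemma swapped_norm:
  assumes e: "generating e" "e \<in> G\<^sub>0" and h: "h \<in> G\<^sub>0" "e \<noteq> h"
    and t: "1 \<le> t" and b: "sigma e h = t * b" and n: "CARD('a) = t * \<nu>"
    and b': "1 \<le> b'" "b' \<le> \<nu>" and inv: "b * b' = 1 + \<nu> * k"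
    and xy: "minimal_solution \<nu> b x y"
  shows "\<exists>j. b' * x + y = \<nu> * (1 + m * j)"
proof -
  have "0 < CARD('a)" by simp
  then have \<nu>: "0 < \<nu>" using n by (metis gr0I mult_0_right)
  have dvd_cancel: "\<nu> dvd y" if "\<nu> dvd b * y" for y
  proof -
    have "\<nu> dvd b' * (b * y)" using that by (rule dvd_mult)
    also have "b' * (b * y) = y + \<nu> * (k * y)"
      using inv by (metis (no_types, lifting) add_mult_distrib mult.assoc mult.commute nat_mult_1)
    finally show ?thesis by (simp add: dvd_add_left_iff)
  qed
  \<comment> \<open>\<open>\<nu>\<close> copies of \<open>h\<close> form an atom, since
    \<open>b\<close> is invertible modulo \<open>\<nu>\<close>.\<close>
  have minh: "minimal_solution \<nu> b 0 \<nu>"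
    unfolding minimal_solution_def
  proof (intro conjI allI impI)
    fix x' y' assume *: "x' \<le> 0" "y' \<le> \<nu>" "\<nu> dvd x' + b * y'"
    then have "\<nu> dvd y'" using dvd_cancel[of y'] by simp
    then have "y' = 0 \<or> y' = \<nu>" using *(2) by (meson dvd_imp_le le_antisym neq0_conv)
    then show "(x', y') = (0, 0) \<or> (x', y') = (0, \<nu>)" using *(1) by auto
  qed (use \<nu> in auto)
  \<comment> \<open>This makes \<open>t\<close> copies of \<open>e\<close> with
    \<open>\<nu> - b'\<close> copies of \<open>h\<close> zero-sum; the atom \<open>P\<close>
    below.\<close>
  have bk: "1 + b * (\<nu> - b') = \<nu> * (b - k)"
  proof -
    obtain c where c: "\<nu> = b' + c" using b'(2) le_Suc_ex by blast
    have "b * \<nu> = b * b' + b * c" unfolding c by (rule add_mult_distrib2)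
    then have \<nu>b: "\<nu> * b = 1 + \<nu> * k + b * c" unfolding inv by (simp only: mult.commute[of \<nu> b])
    have "\<nu> * k \<le> \<nu> * b" using \<nu>b by linarith
    then have "k \<le> b" using \<nu> by simp
    then obtain l where l: "b = k + l" using le_Suc_ex by blast
    have "\<nu> * b = \<nu> * k + \<nu> * l" unfolding l by (rule add_mult_distrib2)
    then have "1 + b * c = \<nu> * l" using \<nu>b by linarith
    moreover have "\<nu> - b' = c" "b - k = l" using c l by simp_all
    ultimately show ?thesis by simp
  qed
  have mine: "minimal_solution \<nu> b 1 (\<nu> - b')"
    unfolding minimal_solution_def
  proof (intro conjI allI impI)
    show "\<nu> dvd 1 + b * (\<nu> - b')" by (simp only: bk dvd_triv_left)
    fix x' y' assume *: "x' \<le> 1" "y' \<le> \<nu> - b'" "\<nu> dvd x' + b * y'"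
    show "(x', y') = (0, 0) \<or> (x', y') = (1, \<nu> - b')"
    proof (cases "x' = 0")
      case True
      then have "\<nu> dvd y'" using *(3) dvd_cancel[of y'] by simp
      then have "y' = 0" using nat_dvd_not_less[of y' \<nu>] *(2) b' by linarith
      then show ?thesis using True by simp
    next
      case False
      then have x': "x' = 1" using * by simp
      have "\<nu> dvd (1 + b * (\<nu> - b')) - (1 + b * y')"
        using * x' by (intro dvd_diff_nat) (simp_all only: bk dvd_triv_left)
      also have "(1 + b * (\<nu> - b')) - (1 + b * y') = b * (\<nu> - b' - y')"
        by (simp add: diff_mult_distrib2 add_mult_distrib2)
      finally have "\<nu> dvd \<nu> - b' - y'" by (rule dvd_cancel)
      then have "\<nu> - b' - y' = 0" using nat_dvd_not_less[of "\<nu> - b' - y'" \<nu>] b' by linarith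
      then show ?thesis using x' * by simp
    qed
  qed simp
  have "\<nu> dvd b' * (x + b * y)" using xy unfolding minimal_solution_def by auto
  also have "b' * (x + b * y) = (b' * x + y) + \<nu> * (k * y)"
  proof -
    have "b' * (x + b * y) = b' * x + b * b' * y" by (simp add: add_mult_distrib2 mult_ac)
    then show ?thesis unfolding inv by (simp add: add_mult_distrib2 mult_ac)
  qed
  finally have "\<nu> dvd b' * x + y" by (simp add: dvd_add_left_iff)
  then obtain N where N: "b' * x + y = \<nu> * N" by blast
  have "N \<noteq> 0"
  proof
    assume "N = 0"
    then have "x = 0 \<and> y = 0" using N b'(1) by simp
    then show False using xy unfolding minimal_solution_def by simp
  qed
  define A where "A = replicate_mset (t * x) e + replicate_mset y h"
  define H where "H = replicate_mset \<nu> h"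
  define P where "P = replicate_mset t e + replicate_mset (\<nu> - b') h"
  note min = minimal_if_minimal_solution[OF e h t b n]
  have A: "A \<in> atoms" unfolding A_def by (rule min[OF xy])
  have H: "H \<in> atoms" using min[OF minh] by (simp add: H_def)
  have P: "P \<in> atoms" using min[OF mine] by (simp add: P_def)
  have sum_rep: "\<Sum>\<^sub># (replicate_mset i (replicate_mset u e + replicate_mset v h)) =
      replicate_mset (i * u) e + replicate_mset (i * v) h" for i u v
    by (induction i) (simp_all add: replicate_mset_add)
  have sumH: "\<Sum>\<^sub># (replicate_mset i H) = replicate_mset (i * \<nu>) h" for i
    using sum_rep[of i 0 \<nu>] by (simp add: H_def)
  \<comment> \<open>The norm argument again, with \<open>H\<close> as reference atom:
    \<open>A\<close> with \<open>x\<close> copies of \<open>H\<close> equals \<open>x\<close> copies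
    of \<open>P\<close> with \<open>N\<close> copies of \<open>H\<close>, so \<open>m\<close>
    divides \<open>N - 1\<close>.\<close>
  define F where "F = {#A#} + replicate_mset x H"
  define F' where "F' = replicate_mset x P + replicate_mset N H"
  have "int m dvd int (size F') - int (size F)"
  proof (rule min_distance_dvd_int_diff[OF _ _ _ pos])
    show "set_mset F \<subseteq> atoms" using A H by (auto simp: F_def split: if_splits)
    show "set_mset F' \<subseteq> atoms" using P H by (auto simp: F'_def split: if_splits)
    have "x * \<nu> = x * b' + x * (\<nu> - b')"
      unfolding add_mult_distrib2[symmetric] using b'(2) by simp
    then have eq: "y + x * \<nu> = x * (\<nu> - b') + N * \<nu>"
      using N by (simp add: mult.commute)
    have "\<Sum>\<^sub># F = replicate_mset (t * x) e + replicate_mset (y + x * \<nu>) h"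
      by (simp add: F_def sumH A_def replicate_mset_add)
    also have "\<dots> = \<Sum>\<^sub># F'"
      unfolding eq by (simp add: F'_def sumH P_def sum_rep replicate_mset_add mult.commute)
    finally show "\<Sum>\<^sub># F = \<Sum>\<^sub># F'" .
  qed
  then have "int m dvd int (N - 1)" using \<open>N \<noteq> 0\<close> by (simp add: F_def F'_def of_nat_diff)
  then have "m dvd N - 1" by simp
  then obtain j where "N - 1 = m * j" ..
  then show ?thesis using N \<open>N \<noteq> 0\<close> by (metis Suc_pred' neq0_conv plus_1_eq_Suc)
qed

text \<open>\<open>t e\<close> and \<open>h\<close> generate the same subgroup, of order
  \<open>\<nu>\<close>, with coordinates \<open>b\<close> and \<open>b'\<close> inverse modulo
  \<open>\<nu>\<close>. Both norms of the atoms are 1 modulo \<open>m\<close>, so the arithmetic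
  structure of two generators applies to \<open>\<nu>\<close>.\<close>

lemma pair_structure:
  assumes e: "generating e" "e \<in> G\<^sub>0" and h: "h \<in> G\<^sub>0" "h \<noteq> iterate_add t e"
    and t: "t = gcd (sigma e h) CARD('a)"
  obtains q r k where "1 \<le> q" "1 \<le> r" "1 \<le> k" "m dvd k" "sigma e h = t * (k * r + 1)"
    "CARD('a) = t * (q * r * k + q + r)" "iterate_add t e = iterate_add (k * q + 1) h"
proof -
  have n0: "0 < CARD('a)" by simp
  have t1: "1 \<le> t" using t n0 by (simp add: Suc_le_eq)
  define b where "b = sigma e h div t"
  define \<nu> where "\<nu> = CARD('a) div t"
  have b: "sigma e h = t * b" and n: "CARD('a) = t * \<nu>" unfolding b_def \<nu>_def t by simp_all
  have neq: "sigma e h \<noteq> t" using h(2) sigma(3)[OF e(1), of h] by metis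
  have eh: "e \<noteq> h"
  proof
    assume "e = h"
    then have "sigma e h = 1" using sigma_self[OF e(1)] by simp
    then show False using neq t by simp
  qed
  \<comment> \<open>\<open>b = 1\<close> would mean \<open>h = t e\<close>.\<close>
  have b2: "2 \<le> b" using sigma(1)[OF e(1), of h] neq unfolding b by (cases b; cases "b - 1") auto
  have "sigma e h \<noteq> CARD('a)" using neq t by auto
  then have "t * b < t * \<nu>" using sigma(2)[OF e(1), of h] b n by linarith
  then have b\<nu>: "b < \<nu>" by simp
  have "coprime b \<nu>" unfolding b_def \<nu>_def t by (rule div_gcd_coprime) simp
  then obtain c where c: "[b * c = 1] (mod \<nu>)" using cong_solve_coprime_nat by auto
  define b' where "b' = c mod \<nu>"
  have bb': "(b * b') mod \<nu> = 1"
    using c b2 b\<nu> unfolding b'_def cong_def by (simp add: mod_mult_right_eq)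
  then have "b' \<noteq> 0" by (intro notI) simp
  then have b': "1 \<le> b'" "b' \<le> \<nu>" using b\<nu> by (auto simp: b'_def intro: less_imp_le)
  define k where "k = b * b' div \<nu>"
  have inv: "b * b' = 1 + \<nu> * k" using bb' by (metis k_def mult_div_mod_eq add.commute)
  have norm: "\<exists>j. x + b * y = \<nu> * (1 + m * j)" if xy: "minimal_solution \<nu> b x y" for x y
  proof -
    obtain j where "weight e (replicate_mset (t * x) e + replicate_mset y h) = CARD('a) * (1 + m * j)"
      using weight_minimal[OF e pos minimal_if_minimal_solution[OF e h(1) eh t1 b n xy]] .
    then have "t * (x + b * y) = t * (\<nu> * (1 + m * j))"
      using b n by (simp add: sigma_self[OF e(1)] algebra_simps)
    then show ?thesis using t1 by auto
  qed
  have norm': "\<exists>j. b' * x + y = \<nu> * (1 + m * j)" if "minimal_solution \<nu> b x y" for x y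
    using swapped_norm[OF e h(1) eh t1 b n b' inv that] .
  have "\<nu> \<le> CARD('a)" using n t1 by simp
  then have "\<nu> \<le> m ^ 2" using le_power2_of_cube[OF cube] by linarith
  then obtain q r where qr: "1 \<le> q" "1 \<le> r" "1 \<le> k" "m dvd k" "b = k * r + 1" "b' = k * q + 1"
      "\<nu> = q * r * k + q + r"
    using two_generator_structure[OF b2 b\<nu> b'(2) inv _ norm norm'] by metis
  have "iterate_add b' h = iterate_add (b' * (t * b)) e"
    by (simp only: iterate_add_mult[of b'] b[symmetric] sigma(3)[OF e(1)])
  also have "b' * (t * b) = t * (b * b')" by (simp add: mult_ac)
  also have "\<dots> = t + k * CARD('a)" unfolding inv n by (simp add: algebra_simps)
  also have "iterate_add \<dots> e = iterate_add t e"
    unfolding iterate_add_distrib iterate_add_mult iterate_add_card by simp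
  finally show ?thesis using that qr b n by simp
qed

end

section \<open>Third elements\<close>

lemma coprime_sigma:
  fixes e g :: "'a::{finite, ab_group_add}"
  assumes "generating e" "generating g"
  shows "coprime (sigma e g) CARD('a)"
proof -
  have "iterate_add (sigma g e * sigma e g) e = iterate_add 1 e"
    using sigma(3)[OF assms(1), of g] sigma(3)[OF assms(2), of e] by (simp add: iterate_add_mult)
  then have "[sigma g e * sigma e g = 1] (mod CARD('a))"
    by (simp only: iterate_add_eq_iff[OF assms(1)] cong_def)
  then show ?thesis
    unfolding coprime_iff_invertible_nat by (intro exI[of _ "sigma g e"]) (simp add: mult.commute)
qed

text \<open>Changing the generator multiplies the coordinate by a unit, so \<open>t\<close> does not
  depend on the generator.\<close>

lemma gcd_sigma_eq:
  fixes e g h :: "'a::{finite, ab_group_add}"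
  assumes "generating e" "generating g"
  shows "gcd (sigma g h) CARD('a) = gcd (sigma e h) CARD('a)"
proof -
  have "iterate_add (sigma e h) e = iterate_add (sigma g h * sigma e g) e"
    using sigma(3)[OF assms(1)] sigma(3)[OF assms(2)] by (simp add: iterate_add_mult)
  then have "[sigma e h = sigma g h * sigma e g] (mod CARD('a))"
    by (simp only: iterate_add_eq_iff[OF assms(1)] cong_def)
  then have "gcd (sigma e h) CARD('a) = gcd (sigma g h * sigma e g) CARD('a)"
    by (rule cong_gcd_eq)
  also have "\<dots> = gcd (sigma g h) CARD('a)"
    using coprime_sigma[OF assms] by (intro gcd_mult_left_right_cancel) (simp only: coprime_commute)
  finally show ?thesis ..
qed

lemma eq_if_add_mult_eq:
  fixes x y m X Y :: nat
  assumes "x + m * X = y + m * Y" "x < m" "y < m"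
  shows "x = y"
  using arg_cong[OF assms(1), of "\<lambda>z. z mod m"] assms(2,3) by simp

text \<open>Pigeonhole: the \<open>t\<close> additional copies of \<open>e\<close> can be spread
  over at most \<open>t\<close> factors. The induction discards one factor containing
  \<open>e\<close> together with one copy.\<close>

lemma ex_factor_subset:
  assumes "\<Sum>\<^sub># F \<subseteq># replicate_mset t e + C" "t < size F"
  shows "\<exists>U\<in>#F. U \<subseteq># C"
  using assms
proof (induction t arbitrary: F)
  case 0
  then obtain U F' where "F = add_mset U F'" by (metis size_eq_Suc_imp_eq_union gr0_implies_Suc)
  then show ?case using 0 by (auto intro: subset_mset.order_trans[OF mset_subset_eq_add_left])
next
  case (Suc t)
  show ?case
  proof (cases "\<exists>U\<in>#F. e \<in># U")
    case True
    then obtain U F' where U: "F = add_mset U F'" "e \<in># U" by (metis mset_add)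
    then obtain U' where U': "U = add_mset e U'" by (metis mset_add)
    have "U' + \<Sum>\<^sub># F' \<subseteq># replicate_mset t e + C" using Suc.prems(1) U(1) U' by simp
    then have "\<Sum>\<^sub># F' \<subseteq># replicate_mset t e + C"
      by (meson mset_subset_eq_add_right subset_mset.order_trans)
    then show ?thesis using Suc.IH[of F'] Suc.prems(2) U(1) by auto
  next
    case False
    have "\<Sum>\<^sub># F \<subseteq># C"
    proof (rule mset_subset_eqI)
      fix x
      show "count (\<Sum>\<^sub># F) x \<le> count C x"
      proof (cases "x = e")
        case True
        then have "x \<notin># \<Sum>\<^sub># F" using False by auto
        then have "count (\<Sum>\<^sub># F) x = 0" by (simp only: not_in_iff)
        then show ?thesis by linarith
      next
        case False
        then show ?thesis using mset_subset_eq_count[OF Suc.prems(1), of x] by (auto split: if_splits)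
      qed
    qed
    moreover obtain U F' where "F = add_mset U F'"
      using Suc.prems(2) by (metis size_eq_Suc_imp_eq_union less_imp_Suc_add)
    ultimately show ?thesis by (auto intro: subset_mset.order_trans[OF mset_subset_eq_add_left])
  qed
qed

context large_min_distance
begin

lemma sum_lt:
  assumes "CARD('a) = t * (q * r * k + q + r)" "1 \<le> t" "1 \<le> q" "1 \<le> r" "1 \<le> k" "m dvd k"
  shows "t * (q + r) < m"
  using sum_lt_of_cube[OF assms(1) cube assms(2-4)] assms(5,6) by (simp add: dvd_imp_le)

lemma generator_pair_structure:
  assumes e: "generating e" "e \<in> G\<^sub>0" and g: "generating g" "g \<in> G\<^sub>0" and "e \<noteq> g"
  obtains q r k where "1 \<le> q" "1 \<le> r" "1 \<le> k" "m dvd k" "sigma e g = k * r + 1"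
    "sigma g e = k * q + 1" "CARD('a) = q * r * k + q + r"
proof -
  have t: "1 = gcd (sigma e g) CARD('a)"
    using coprime_sigma[OF e(1) g(1)] by (simp add: coprime_iff_gcd_eq_1)
  have "g \<noteq> iterate_add 1 e" using \<open>e \<noteq> g\<close> by simp
  from pair_structure[OF e g(2) this t]
  obtain q r k where *: "1 \<le> q" "1 \<le> r" "1 \<le> k" "m dvd k" "sigma e g = k * r + 1"
    "CARD('a) = q * r * k + q + r" "iterate_add 1 e = iterate_add (k * q + 1) g"
    by (metis mult_1)
  \<comment> \<open>\<open>k q + 1\<close> must lie in the range of \<open>sigma\<close>, not merely
    be congruent to its value.\<close>
  have "k * q * 1 \<le> k * q * r" using *(2) by (rule mult_le_mono2)
  moreover have "q * r * k = k * q * r" by (simp add: mult_ac)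
  ultimately have "k * q + 1 \<le> CARD('a)" using *(2,6) by linarith
  then have "sigma g e = k * q + 1"
    using *(7) by (intro sigma_eqI[OF g(1)]) simp_all
  then show ?thesis using that * by blast
qed

text \<open>\<open>t r\<close> copies of \<open>g\<close> with \<open>q\<close> copies of
  \<open>h\<close> have norm 1 with respect to \<open>g\<close>, hence form an atom. Its norm with
  respect to \<open>e\<close> is at most \<open>t r + q < m\<close> and is 1 modulo
  \<open>m\<close>, so it is 1 too.\<close>

lemma small_relation:
  assumes e: "generating e" "e \<in> G\<^sub>0" and g: "generating g" "g \<in> G\<^sub>0" and h: "h \<in> G\<^sub>0"
    and t: "1 \<le> t" and qrk: "1 \<le> q" "1 \<le> r" "1 \<le> k" "m dvd k"
    and s: "sigma g h = t * (k * r + 1)" and n: "CARD('a) = t * (q * r * k + q + r)"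
  shows "t * r * sigma e g + q * sigma e h = CARD('a)"
proof -
  let ?A = "replicate_mset (t * r) g + replicate_mset q h"
  have "weight g ?A = CARD('a)" using s n by (simp add: sigma_self[OF g(1)] algebra_simps)
  moreover have "set_mset ?A \<subseteq> G\<^sub>0" using g h by (auto split: if_splits)
  ultimately have "?A \<in> atoms" using minimal_if_weight_eq_card[OF g(1)] by blast
  then obtain j where "weight e ?A = CARD('a) * (1 + m * j)" using weight_minimal[OF e pos] by blast
  then have j: "t * r * sigma e g + q * sigma e h = CARD('a) * (1 + m * j)" by simp
  have "j = 0"
  proof (rule ccontr)
    assume "j \<noteq> 0"
    have "t * (q + r) < m" using sum_lt[OF n t qrk] .
    moreover have "q \<le> t * q" using t by simp
    ultimately have lt: "t * r + q < m" unfolding add_mult_distrib2 by linarith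
    have "t * r * sigma e g + q * sigma e h \<le> t * r * CARD('a) + q * CARD('a)"
      using sigma(2)[OF e(1)] by (intro add_mono mult_le_mono2) auto
    also have "\<dots> = CARD('a) * (t * r + q)" by (simp add: algebra_simps)
    also have "\<dots> < CARD('a) * m" using lt by simp
    also have "\<dots> \<le> CARD('a) * (1 + m * j)" using \<open>j \<noteq> 0\<close> mult_le_mono2[of 1 j m] by (intro mult_le_mono2) linarith
    finally show False using j by simp
  qed
  then show ?thesis using j by simp
qed

text \<open>Otherwise the pairs \<open>(e, g)\<close>, \<open>(e, h)\<close> and
  \<open>(g, h)\<close> all have the rigid structure, and the resulting three expressions for the
  group order are incompatible.\<close>

lemma multiple_of_generator:
  assumes e: "generating e" "e \<in> G\<^sub>0" and g: "generating g" "g \<in> G\<^sub>0" and "e \<noteq> g"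
    and h: "h \<in> G\<^sub>0" and t: "t = gcd (sigma e h) CARD('a)"
  shows "h = iterate_add t e \<or> h = iterate_add t g"
proof (rule ccontr)
  assume "\<not> (h = iterate_add t e \<or> h = iterate_add t g)"
  then have he: "h \<noteq> iterate_add t e" and hg: "h \<noteq> iterate_add t g" by auto
  have t': "t = gcd (sigma g h) CARD('a)" using t gcd_sigma_eq[OF e(1) g(1)] by simp
  have t1: "1 \<le> t" using t by (simp add: Suc_le_eq)
  obtain q r k where g_e: "1 \<le> q" "1 \<le> r" "1 \<le> k" "m dvd k" "sigma e g = k * r + 1"
    "sigma g e = k * q + 1" "CARD('a) = q * r * k + q + r"
    using generator_pair_structure[OF e g \<open>e \<noteq> g\<close>] .
  obtain q1 r1 k1 where h_e: "1 \<le> q1" "1 \<le> r1" "1 \<le> k1" "m dvd k1"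
    "sigma e h = t * (k1 * r1 + 1)" "CARD('a) = t * (q1 * r1 * k1 + q1 + r1)"
    "iterate_add t e = iterate_add (k1 * q1 + 1) h"
    using pair_structure[OF e h he t] .
  obtain q2 r2 k2 where h_g: "1 \<le> q2" "1 \<le> r2" "1 \<le> k2" "m dvd k2"
    "sigma g h = t * (k2 * r2 + 1)" "CARD('a) = t * (q2 * r2 * k2 + q2 + r2)"
    "iterate_add t g = iterate_add (k2 * q2 + 1) h"
    using pair_structure[OF g h hg t'] .
  have rel: "t * r2 * (k * r + 1) + q2 * (t * (k1 * r1 + 1)) = CARD('a)"
    using small_relation[OF e g h t1 h_g(1-6)] unfolding g_e(5) h_e(5) .
  have lt: "q + r < m" "t * (q1 + r1) < m" "t * (q2 + r2) < m"
    using sum_lt[of 1 q r k] sum_lt[OF h_e(6) t1 h_e(1-4)] sum_lt[OF h_g(6) t1 h_g(1-4)] g_e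
    by simp_all
  obtain u u1 where u: "k = m * u" "k1 = m * u1" using g_e(4) h_e(4) by blast
  have n0: "CARD('a) = (q + r) + m * (q * r * u)" using g_e(7) unfolding u by (simp add: mult_ac)
  have n1: "CARD('a) = t * (q1 + r1) + m * (t * q1 * r1 * u1)"
    using h_e(6) unfolding u by (simp add: algebra_simps)
  have n2: "CARD('a) = t * (q2 + r2) + m * (t * r2 * u * r + q2 * t * u1 * r1)"
    using rel unfolding u by (simp add: algebra_simps)
  \<comment> \<open>All three sums are the residue of the group order modulo
    \<open>m\<close>.\<close>
  have S: "t * (q2 + r2) = q + r" "t * (q2 + r2) = t * (q1 + r1)"
    using n0 n1 n2 lt eq_if_add_mult_eq by metis+
  show False
  \<comment> \<open>Replacing the larger of the two coefficients in \<open>rel\<close> by the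
    smaller makes the order at least \<open>(q + r) (k r + 1)\<close>, or the analogue for
    \<open>h\<close>, which exceeds it.\<close>
  proof (cases "k * r \<le> k1 * r1")
    case True
    have "(q + r) * (k * r + 1) = t * r2 * (k * r + 1) + q2 * (t * (k * r + 1))"
      unfolding S(1)[symmetric] by (simp add: algebra_simps)
    also have "\<dots> \<le> CARD('a)" unfolding rel[symmetric] using True by (intro add_left_mono mult_le_mono2) simp
    finally have "r * (k * r) \<le> 0" using g_e(7) by (simp add: algebra_simps)
    then show False using g_e by simp
  next
    case False
    have "t * (q1 + r1) * (k1 * r1 + 1) = t * r2 * (k1 * r1 + 1) + q2 * (t * (k1 * r1 + 1))"
      unfolding S(2)[symmetric] by (simp add: algebra_simps)
    also have "\<dots> \<le> CARD('a)" unfolding rel[symmetric] using False by (intro add_right_mono mult_le_mono2) simp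
    finally have "t * (r1 * (k1 * r1)) \<le> 0" using h_e(6) by (simp add: algebra_simps)
    then show False using h_e t1 by simp
  qed
qed

text \<open>The pair \<open>(g, h)\<close> gives parameters \<open>q2\<close>, \<open>r2\<close>.
  The short relation read with respect to \<open>e\<close>, compared with the formula for the order,
  yields \<open>q = t r2\<close> and \<open>r = t q2\<close>.\<close>

lemma dvd_if_multiples_differ:
  assumes e: "generating e" "e \<in> G\<^sub>0" and g: "generating g" "g \<in> G\<^sub>0"
    and qrk: "1 \<le> q" "1 \<le> r" "1 \<le> k" "m dvd k" "sigma e g = k * r + 1" "CARD('a) = q * r * k + q + r"
    and h: "h \<in> G\<^sub>0" and t: "t = gcd (sigma e h) CARD('a)"
    and eq: "h = iterate_add t e" and neq: "h \<noteq> iterate_add t g"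
  shows "t dvd q" "t dvd r"
proof -
  have t': "t = gcd (sigma g h) CARD('a)" using t gcd_sigma_eq[OF e(1) g(1)] by simp
  have t1: "1 \<le> t" using t by (simp add: Suc_le_eq)
  have "t dvd CARD('a)" using t by simp
  then have "t \<le> CARD('a)" by (simp add: dvd_imp_le)
  then have s: "sigma e h = t" using eq t1 by (intro sigma_eqI[OF e(1)])
  obtain q2 r2 k2 where h_g: "1 \<le> q2" "1 \<le> r2" "1 \<le> k2" "m dvd k2"
    "sigma g h = t * (k2 * r2 + 1)" "CARD('a) = t * (q2 * r2 * k2 + q2 + r2)"
    "iterate_add t g = iterate_add (k2 * q2 + 1) h"
    using pair_structure[OF g h neq t'] .
  have rel: "t * r2 * (k * r + 1) + q2 * t = CARD('a)"
    using small_relation[OF e g h t1 h_g(1-6)] unfolding qrk(5) s .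
  have lt: "q + r < m" "t * (q2 + r2) < m"
    using sum_lt[of 1 q r k] sum_lt[OF h_g(6) t1 h_g(1-4)] qrk by simp_all
  obtain u where u: "k = m * u" using qrk(4) by blast
  have n0: "CARD('a) = (q + r) + m * (q * r * u)" using qrk(6) unfolding u by (simp add: mult_ac)
  have n2: "CARD('a) = t * (q2 + r2) + m * (t * r2 * u * r)"
    using rel unfolding u by (simp add: algebra_simps)
  have S: "t * (q2 + r2) = q + r" using n0 n2 lt eq_if_add_mult_eq by metis
  have "t * (q2 + r2) + (k * r) * (t * r2) = (q + r) + (k * r) * q"
    using rel qrk(6) by (simp add: algebra_simps)
  then have "t * r2 = q" using S qrk(2,3) by simp
  moreover from this have "t * q2 = r" using S by (simp add: algebra_simps)
  ultimately show "t dvd q" "t dvd r" by auto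
qed

text \<open>If the new sequence had at least two factors, their number would exceed \<open>m \<ge> t\<close> because it is
  congruent to 1 modulo \<open>m\<close>, so some factor would avoid the \<open>t\<close> new terms.\<close>

lemma expand_multiple:
  assumes e: "generating e" "e \<in> G\<^sub>0" and A: "add_mset (iterate_add t e) C \<in> atoms"
    and t: "1 \<le> t" "t \<le> m" "t \<le> CARD('a)"
  shows "replicate_mset t e + C \<in> atoms"
proof -
  let ?A = "add_mset (iterate_add t e) C"
  let ?B = "replicate_mset t e + C"
  have s: "sigma e (iterate_add t e) = t" using t by (intro sigma_eqI[OF e(1)]) auto
  have wt: "weight e ?B = weight e ?A" by (simp add: s sigma_self[OF e(1)])
  have "?B \<in> zero_sum_seqs G\<^sub>0"
    using minimal_zero_sum_seqsD(1,2)[OF A] e(2)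
    by (auto simp: zero_sum_seqs_def sum_mset_replicate split: if_splits)
  then obtain F where F: "set_mset F \<subseteq> atoms" "\<Sum>\<^sub># F = ?B" using ex_factorization by blast
  \<comment> \<open>Atoms have norm 1 modulo \<open>m\<close>, so the norm of a product gives its
    number of factors modulo \<open>m\<close>.\<close>
  have weight_sum: "\<exists>i. weight e (\<Sum>\<^sub># F) = CARD('a) * (size F + m * i)" if "set_mset F \<subseteq> atoms" for F
    using that
  proof (induction F)
    case empty
    then show ?case by simp
  next
    case (add U F)
    obtain j where "weight e U = CARD('a) * (1 + m * j)"
      using weight_minimal[OF e pos, of U] add.prems by auto
    moreover obtain i where "weight e (\<Sum>\<^sub># F) = CARD('a) * (size F + m * i)" using add by auto
    ultimately have "weight e (\<Sum>\<^sub># (add_mset U F)) = CARD('a) * (size (add_mset U F) + m * (i + j))"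
      by (simp add: algebra_simps)
    then show ?case by blast
  qed
  obtain i where i: "weight e ?B = CARD('a) * (size F + m * i)" using weight_sum F by metis
  obtain j where "weight e ?A = CARD('a) * (1 + m * j)" using weight_minimal[OF e pos A] .
  then have "CARD('a) * (size F + m * i) = CARD('a) * (1 + m * j)" using i wt by metis
  then have eq: "size F + m * i = 1 + m * j" unfolding mult_cancel1 by simp
  have "F \<noteq> {#}" using F(2) t(1) by auto
  then have F1: "1 \<le> size F" by (cases F) auto
  have "size F \<le> m"
  proof (rule ccontr)
    assume "\<not> size F \<le> m"
    then have "t < size F" using t(2) by linarith
    then obtain U where U: "U \<in># F" "U \<subseteq># C"
      using ex_factor_subset[of F t e C] F(2) by auto
    have "U \<in> atoms" using U(1) F(1) by blast
    then have "U \<noteq> {#}" "\<Sum>\<^sub># U = 0" by (auto dest: minimal_zero_sum_seqsD)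
    moreover have "U \<subseteq># ?A" using U(2) by (simp add: subset_mset.trans[of U C])
    \<comment> \<open>A factor inside \<open>C\<close> would be a proper zero-sum part of the
      original atom.\<close>
    ultimately have "U = ?A" using minimal_zero_sum_seqsD(4)[OF A] by blast
    then show False using size_mset_mono[OF U(2)] by simp
  qed
  moreover have "m dvd size F - 1"
  proof -
    have "int m dvd int m * (int j - int i)" by simp
    also have "int m * (int j - int i) = int (size F - 1)"
      using arg_cong[OF eq, of int] F1 by (simp add: of_nat_diff algebra_simps)
    finally show ?thesis by simp
  qed
  ultimately have "size F = 1"
    using F1 pos dvd_imp_le[of m "size F - 1"] by linarith
  then obtain U where "F = {#U#}" by (metis size_1_singleton_mset)
  then show ?thesis using F by simp
qed

end

section \<open>The greatest common divisor of the norms\<close>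

lemma sum_mset_eq_sum_count:
  fixes f :: "'b \<Rightarrow> nat"
  shows "(\<Sum>x\<in>#A. f x) = (\<Sum>x\<in>set_mset A. count A x * f x)"
proof (induction A)
  case (add a A)
  have "(\<Sum>x\<in>set_mset (add_mset a A). count (add_mset a A) x * f x)
      = (\<Sum>x\<in>set_mset (add_mset a A). count A x * f x + (if x = a then f x else 0))"
    by (rule sum.cong) auto
  also have "\<dots> = (\<Sum>x\<in>set_mset (add_mset a A). count A x * f x) + f a"
    by (simp add: sum.distrib)
  also have "(\<Sum>x\<in>set_mset (add_mset a A). count A x * f x) = (\<Sum>x\<in>set_mset A. count A x * f x)"
    by (rule sum.mono_neutral_right) (auto simp: not_in_iff)
  finally show ?case using add.IH by simp
qed simp

text \<open>The common part \<open>h = gcd q r\<close> is removed first; afterwards \<open>gcd k (n / h)\<close> divides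
  \<open>q / h + r / h\<close> and is therefore coprime to \<open>r / h\<close>.\<close>

lemma gcd_dvd_norm_difference:
  fixes n q r k \<gamma> w :: nat and x y D :: int
  assumes n: "n = q * r * k + q + r" and "1 \<le> q" "1 \<le> r" "1 \<le> k"
    and \<gamma>: "\<gamma> = gcd n (k * r)" and w: "w * \<gamma> = k * r"
    and D: "int n * D = int k * (int r * y - int q * x)"
  shows "int (gcd k w) dvd D"
proof -
  define h where "h = gcd q r"
  have h0: "h \<noteq> 0" using assms(2) by (simp add: h_def)
  obtain q1 r1 where qr: "q = h * q1" "r = h * r1" unfolding h_def
    using gcd_dvd1 gcd_dvd2 by (metis dvdE)
  have cop: "coprime q1 r1"
    using gcd_mult_distrib_nat[of h q1 r1] h0 unfolding qr[symmetric] h_def[symmetric]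
    by (simp add: coprime_iff_gcd_eq_1)
  define n1 where "n1 = h * q1 * r1 * k + q1 + r1"
  have n1: "n = h * n1" unfolding n qr n1_def by (simp add: algebra_simps)
  have "r1 \<noteq> 0" using qr assms(3) by (intro notI) simp
  then have n10: "n1 \<noteq> 0" by (simp add: n1_def)
  define c where "c = gcd k n1"
  have c0: "c \<noteq> 0" using n10 by (simp add: c_def)
  obtain k' n' where kn: "k = c * k'" "n1 = c * n'" unfolding c_def
    using gcd_dvd1 gcd_dvd2 by (metis dvdE)
  have cop': "coprime k' n'"
    using gcd_mult_distrib_nat[of c k' n'] c0 unfolding kn[symmetric] c_def[symmetric]
    by (simp add: coprime_iff_gcd_eq_1)
  \<comment> \<open>Cancelling \<open>h c\<close> leaves \<open>n' D = k' (r1 y - q1 x)\<close> with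
    \<open>k'\<close> coprime to \<open>n'\<close>, so \<open>k'\<close> divides
    \<open>D\<close>.\<close>
  have "int (h * c) * (int n' * D) = int (h * c) * (int k' * (int r1 * y - int q1 * x))"
    using D unfolding n1 qr kn by (simp add: algebra_simps)
  then have "int n' * D = int k' * (int r1 * y - int q1 * x)" using h0 c0 by simp
  then have "int k' dvd int n' * D" by simp
  moreover have "coprime (int k') (int n')" using cop' by simp
  ultimately have k'D: "int k' dvd D" by (simp add: coprime_dvd_mult_right_iff)
  have "c dvd n1" "c dvd h * q1 * r1 * k" by (auto simp: c_def)
  then have c_sum: "c dvd q1 + r1" unfolding n1_def by (simp add: add.assoc dvd_add_right_iff)
  have "coprime c r1"
  proof (rule coprimeI)
    fix p assume "p dvd c" "p dvd r1"
    then have "p dvd q1" using c_sum dvd_trans dvd_add_left_iff by blast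
    then show "is_unit p" using cop \<open>p dvd r1\<close> coprime_common_divisor by blast
  qed
  \<comment> \<open>It remains to see that \<open>gcd k w\<close> divides \<open>k'\<close>: it
    divides both \<open>k' r1\<close> and \<open>k = k' c\<close>.\<close>
  then have "gcd (k' * r1) (k' * c) = k'"
    by (simp add: gcd_mult_distrib_nat[symmetric] gcd.commute coprime_iff_gcd_eq_1)
  moreover have "gcd k w dvd k' * r1"
  proof -
    have "h * c dvd \<gamma>" unfolding \<gamma> n1 qr kn by (auto simp: mult_ac)
    then obtain \<gamma>' where "\<gamma> = h * c * \<gamma>'" by blast
    then have "h * c * (w * \<gamma>') = h * c * (k' * r1)" using w unfolding qr kn by (simp add: mult_ac)
    then have "w * \<gamma>' = k' * r1" using h0 c0 by simp
    then have "w dvd k' * r1" by (metis dvd_triv_left)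
    then show ?thesis by (meson dvd_trans gcd_dvd2)
  qed
  moreover have "gcd k w dvd k' * c" using kn(1) by (metis gcd_dvd1 mult.commute)
  ultimately have "gcd k w dvd k'" by (metis gcd_greatest)
  then show ?thesis using k'D dvd_trans int_dvd_int_iff by blast
qed

text \<open>The product is the lcm of \<open>m\<close> and \<open>w\<close>. As \<open>m\<close>
  divides \<open>k\<close>, distributivity turns its gcd with \<open>k\<close> into the lcm of
  \<open>m\<close> and \<open>gcd k w\<close>, which is \<open>m\<close>.\<close>

lemma gcd_lcm_adjust:
  fixes k w m :: nat
  assumes "gcd k w dvd m" "m dvd k" "0 < k"
  shows "gcd k (w * (m div gcd m w)) = m"
proof -
  define u where "u = gcd m w"
  have m0: "m \<noteq> 0" using assms by (intro notI) simp
  then have u0: "u \<noteq> 0" by (simp add: u_def)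
  obtain f w' where fw: "m = u * f" "w = u * w'" unfolding u_def
    using gcd_dvd1 gcd_dvd2 by (metis dvdE)
  have cop: "coprime f w'"
    using gcd_mult_distrib_nat[of u f w'] u0 unfolding fw[symmetric] u_def[symmetric]
    by (simp add: coprime_iff_gcd_eq_1)
  obtain \<kappa> where \<kappa>: "k = m * \<kappa>" using assms(2) by blast
  have "coprime \<kappa> w'"
  proof (rule coprimeI)
    fix p assume p: "p dvd \<kappa>" "p dvd w'"
    have "u * p dvd k" unfolding \<kappa> fw(1) using p(1) by (simp add: mult.assoc)
    moreover have "u * p dvd w" unfolding fw(2) using p(2) by simp
    ultimately have "u * p dvd u * f" using assms(1) fw(1) by (metis dvd_trans gcd_greatest)
    then have "p dvd f" using u0 by simp
    then show "is_unit p" using cop p(2) coprime_common_divisor by blast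
  qed
  then have "gcd (m * \<kappa>) (m * w') = m"
    by (simp add: gcd_mult_distrib_nat[symmetric] coprime_iff_gcd_eq_1)
  moreover have "m div gcd m w = f" using fw(1) u0 unfolding u_def[symmetric] by simp
  then have "w * (m div gcd m w) = m * w'" using fw by (simp add: mult_ac)
  ultimately show ?thesis using \<kappa> by simp
qed

section \<open>Atoms over a set with two fixed generators\<close>

locale generator_pair = large_min_distance G\<^sub>0
  for G\<^sub>0 :: "'a::{finite, ab_group_add} set" +
  fixes e g :: 'a and q r k :: nat
  assumes e: "generating e" "e \<in> G\<^sub>0" and g: "generating g" "g \<in> G\<^sub>0" and neq: "e \<noteq> g"
    and qrk: "1 \<le> q" "1 \<le> r" "1 \<le> k" "m dvd k" "sigma e g = k * r + 1"
    and n: "CARD('a) = q * r * k + q + r" and sigma_g_e: "sigma g e = k * q + 1"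
begin

text \<open>Here \<open>t\<close> is the coordinate of \<open>h\<close> for both generators, so
  these terms contribute equally to both norms.\<close>

definition common :: "'a set" where
  "common = {h. \<exists>t. t dvd CARD('a) \<and> h = iterate_add t e \<and> h = iterate_add t g}"

lemma swapped: "generator_pair G\<^sub>0 g e r q k"
  using e g neq qrk n sigma_g_e by unfold_locales (auto simp: mult_ac)

lemma n_eq: "CARD('a) = q * sigma e g + r" "CARD('a) = q + r * sigma g e"
  unfolding qrk(5) sigma_g_e using n by (simp_all add: algebra_simps)

lemma common_sigma:
  assumes "h \<in> common"
  obtains t where "t dvd CARD('a)" "1 \<le> t" "t \<le> CARD('a)" "h = iterate_add t e" "h = iterate_add t g"
    "sigma e h = t" "sigma g h = t"
proof -
  obtain t where t: "t dvd CARD('a)" "h = iterate_add t e" "h = iterate_add t g"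
    using assms by (auto simp: common_def)
  have "t \<noteq> 0" using t(1) by (intro notI) simp
  then have t': "1 \<le> t" "t \<le> CARD('a)" using t(1) by (simp_all add: dvd_imp_le Suc_le_eq)
  then have "sigma e h = t" "sigma g h = t"
    using sigma_eqI[OF e(1) t(2)] sigma_eqI[OF g(1) t(3)] by simp_all
  then show ?thesis using that t t' by blast
qed

lemma cases_of_element:
  assumes h: "h \<in> G\<^sub>0"
  obtains (common) "h \<in> common"
  | (multiple_e) t where "h = iterate_add t e" "1 \<le> t" "t dvd q"
  | (multiple_g) t where "h = iterate_add t g" "1 \<le> t" "t dvd q"
proof -
  define t where t: "t = gcd (sigma e h) CARD('a)"
  have t': "t = gcd (sigma g h) CARD('a)" unfolding t using gcd_sigma_eq[OF e(1) g(1)] by simp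
  have t1: "1 \<le> t" "t dvd CARD('a)" unfolding t by (simp_all add: Suc_le_eq)
  have n': "CARD('a) = r * q * k + r + q" using n by (simp add: mult_ac)
  consider "h = iterate_add t e" "h = iterate_add t g" | "h = iterate_add t e" "h \<noteq> iterate_add t g"
    | "h = iterate_add t g" "h \<noteq> iterate_add t e"
    using multiple_of_generator[OF e g neq h t] by blast
  then show ?thesis
  proof cases
    case 1
    then have "h \<in> common" using t1(2) unfolding common_def by blast
    then show ?thesis by (rule that(1))
  next
    case 2
    then have "t dvd q" by (rule dvd_if_multiples_differ[OF e g qrk n h t])
    then show ?thesis using that(2) 2 t1 by blast
  next
    case 3
    \<comment> \<open>Exchanging \<open>e\<close> and \<open>g\<close> exchanges \<open>q\<close>
      and \<open>r\<close>, so the second conclusion is the one about \<open>q\<close>.\<close>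
    then have "t dvd q"
      by (rule dvd_if_multiples_differ(2)[OF g e qrk(2,1,3,4) sigma_g_e n' h t'])
    then show ?thesis using that(3) 3 t1 by blast
  qed
qed

text \<open>A term outside \<open>{e, g} \<union> common\<close> is \<open>t e\<close> or
  \<open>t g\<close> with \<open>t \<le> q \<le> m\<close>. Expanding it into \<open>t\<close>
  copies of the generator keeps an atom, and keeps the weight because \<open>t * sigma e g\<close>
  is still at most the group order.\<close>

lemma ex_reduced_atom:
  assumes "A \<in> atoms"
  shows "\<exists>B\<in>atoms. weight e B = weight e A \<and> set_mset B \<subseteq> {e, g} \<union> common"
  using assms
proof (induction "size {#h \<in># A. h \<notin> {e, g} \<union> common#}" arbitrary: A rule: less_induct)
  case less
  let ?bad = "\<lambda>A. {#h \<in># A. h \<notin> {e, g} \<union> common#}"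
  have "q + r < m" using sum_lt[of 1 q r k] n qrk by simp
  then have qm: "q \<le> m" by simp
  have qn: "q \<le> CARD('a)" using n by simp
  show ?case
  proof (cases "set_mset A \<subseteq> {e, g} \<union> common")
    case True
    then show ?thesis using less.prems by blast
  next
    case False
    then obtain h C where h: "A = add_mset h C" "h \<notin> {e, g} \<union> common"
      by (metis mset_add subsetI)
    have step: ?thesis
      if x: "x \<in> {e, g}" and B: "replicate_mset t x + C \<in> atoms"
        and w: "t * sigma e x = sigma e h" for t x
    proof -
      have "size (?bad (replicate_mset t x + C)) = size (?bad C)" using x by auto
      also have "\<dots> < size (?bad A)" using h by simp
      finally obtain D where "D \<in> atoms" "weight e D = weight e (replicate_mset t x + C)"
        "set_mset D \<subseteq> {e, g} \<union> common"
        using less.hyps[OF _ B] by blast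
      moreover have "weight e (replicate_mset t x + C) = weight e A" using h(1) w by simp
      ultimately show ?thesis by auto
    qed
    have "h \<in> G\<^sub>0" using h(1) minimal_zero_sum_seqsD(1)[OF less.prems] by simp
    then show ?thesis
    proof (cases rule: cases_of_element)
      case common
      then show ?thesis using h(2) by simp
    next
      case (multiple_e t)
      then have t: "t \<le> q" using qrk(1) by (simp add: dvd_imp_le)
      have "replicate_mset t e + C \<in> atoms"
        using less.prems t qm qn multiple_e(2) unfolding h(1) multiple_e(1)
        by (intro expand_multiple[OF e]) simp_all
      moreover have "t * sigma e e = sigma e h"
        using sigma_eqI[OF e(1) multiple_e(1,2)] t qn by (simp add: sigma_self[OF e(1)])
      ultimately show ?thesis using step by blast
    next
      case (multiple_g t)
      then have t: "t \<le> q" using qrk(1) by (simp add: dvd_imp_le)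
      have "replicate_mset t g + C \<in> atoms"
        using less.prems t qm qn multiple_g(2) unfolding h(1) multiple_g(1)
        by (intro expand_multiple[OF g]) simp_all
      moreover have "t * sigma e g = sigma e h"
      proof (rule sigma_eqI[OF e(1), symmetric])
        show "h = iterate_add (t * sigma e g) e"
          using multiple_g(1) sigma(3)[OF e(1), of g] by (simp add: iterate_add_mult)
        show "1 \<le> t * sigma e g" using multiple_g(2) qrk(5) by simp
        show "t * sigma e g \<le> CARD('a)" using mult_le_mono1[OF t, of "sigma e g"] n_eq(1) by linarith
      qed
      ultimately show ?thesis using step by blast
    qed
  qed
qed

text \<open>If \<open>h = t e = t g\<close> then \<open>n\<close> divides \<open>t (q + r)\<close>, so there are at most \<open>q + r\<close> such \<open>h\<close>.\<close>

lemma common_subset: "common \<subseteq> (\<lambda>i. iterate_add (CARD('a) * i div (q + r)) e) ` {1..q + r}"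
proof
  fix h assume "h \<in> common"
  then obtain t where t: "1 \<le> t" "t \<le> CARD('a)" "h = iterate_add t e" "h = iterate_add t g"
    using common_sigma by metis
  have "iterate_add (t * sigma e g) e = iterate_add t e"
    using t(3,4) sigma(3)[OF e(1), of g] by (simp add: iterate_add_mult)
  then have "[t * (k * r) + t = 0 + t] (mod CARD('a))"
    unfolding iterate_add_eq_iff[OF e(1)] cong_def qrk(5) by (simp add: algebra_simps)
  then have "[t * (k * r) = 0] (mod CARD('a))" by (simp only: cong_add_rcancel_nat)
  then have "CARD('a) dvd t * (k * r) * q" by (simp add: cong_0_iff)
  \<comment> \<open>Since \<open>q r k\<close> is the order minus \<open>q + r\<close>, divisibility
    passes to \<open>t (q + r)\<close>.\<close>
  moreover have "t * (k * r) * q + t * (q + r) = t * CARD('a)" using n by (simp add: algebra_simps)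
  ultimately have "CARD('a) dvd t * (q + r)" by (metis dvd_add_right_iff dvd_triv_right)
  then obtain i where i: "t * (q + r) = CARD('a) * i" by blast
  have "CARD('a) * i \<le> CARD('a) * (q + r)" unfolding i[symmetric] using t(2) by (rule mult_le_mono1)
  then have "i \<le> q + r" by simp
  moreover have "i \<noteq> 0" using i t(1) qrk(1) by (intro notI) simp
  moreover have "CARD('a) * i div (q + r) = t" unfolding i[symmetric] using qrk(1) by simp
  ultimately show "h \<in> (\<lambda>i. iterate_add (CARD('a) * i div (q + r)) e) ` {1..q + r}"
    using t(3) by (intro image_eqI[of _ _ i]) auto
qed

text \<open>Each distinct term adds at most 1 to the norm, and there are at most
  \<open>q + r + 2 \<le> m\<close> of them. A norm that is at most \<open>m\<close> and 1 modulo
  \<open>m\<close> equals 1.\<close>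

lemma weight_eq_if_count_less:
  assumes A: "A \<in> atoms" "set_mset A \<subseteq> {e, g} \<union> common" and count: "count A g < q"
  shows "weight e A = CARD('a)"
proof -
  let ?I = "(\<lambda>i. iterate_add (CARD('a) * i div (q + r)) e) ` {1..q + r}"
  have le: "count A h * sigma e h \<le> CARD('a)" if "h \<in># A" for h
  proof (cases "h = g")
    case True
    have "count A g * sigma e g \<le> q * sigma e g" using count by (intro mult_le_mono1) simp
    then have "count A g * sigma e g \<le> CARD('a)" using n_eq(1) by linarith
    then show ?thesis using True by simp
  next
    case False
    obtain t where t: "t dvd CARD('a)" "h = iterate_add t e" "sigma e h = t"
    proof (cases "h = e")
      case True
      then show ?thesis using that[of 1] sigma_self[OF e(1)] by simp
    next
      case False
      then have "h \<in> common" using \<open>h \<noteq> g\<close> \<open>h \<in># A\<close> A(2) by auto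
      then show ?thesis using common_sigma that by metis
    qed
    obtain s where s: "CARD('a) = t * s" using t(1) by blast
    \<comment> \<open>\<open>s\<close> copies of \<open>h\<close> already sum to zero, so an atom
      cannot contain more.\<close>
    have "count A h \<le> s"
    proof (rule ccontr)
      assume "\<not> count A h \<le> s"
      then have gt: "s < count A h" by simp
      then have "replicate_mset s h \<subseteq># A" by (simp add: count_le_replicate_mset_subset_eq[symmetric])
      moreover have "s \<noteq> 0" using s by (intro notI) simp
      then have "replicate_mset s h \<noteq> {#}" by simp
      moreover have "\<Sum>\<^sub># (replicate_mset s h) = 0"
        unfolding sum_mset_eq_0_iff[OF e(1)] using s t(3) by (simp add: mult.commute)
      ultimately have "replicate_mset s h = A" using minimal_zero_sum_seqsD(4)[OF A(1)] by blast
      then have "count A h = s" by (metis count_replicate_mset)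
      then show False using gt by simp
    qed
    then show ?thesis using s t(3) by (simp add: mult.commute)
  qed
  have sub: "set_mset A \<subseteq> {e, g} \<union> ?I" using A(2) common_subset by blast
  have "card (set_mset A) \<le> card ({e, g} \<union> ?I)" using sub by (intro card_mono) auto
  also have "\<dots> \<le> card {e, g} + card ?I" by (rule card_Un_le)
  also have "\<dots> \<le> 2 + (q + r)" using card_image_le[of "{1..q + r}"] by (intro add_mono) (auto simp: card_insert_if)
  also have "\<dots> \<le> m" using sum_add_2_le_of_cube[OF n cube qrk(1,2)] qrk(3,4) by (simp add: dvd_imp_le)
  finally have card: "card (set_mset A) \<le> m" .
  have "weight e A = (\<Sum>h\<in>set_mset A. count A h * sigma e h)"
    unfolding weight_def by (rule sum_mset_eq_sum_count)
  also have "\<dots> \<le> card (set_mset A) * CARD('a)" using sum_bounded_above[of "set_mset A" "\<lambda>h. count A h * sigma e h" "CARD('a)"] le by simp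
  also have "\<dots> \<le> m * CARD('a)" using card by (rule mult_le_mono1)
  finally have W: "weight e A \<le> CARD('a) * m" by (simp add: mult.commute)
  obtain j where j: "weight e A = CARD('a) * (1 + m * j)" using weight_minimal[OF e pos A(1)] .
  have "j = 0"
  proof (rule ccontr)
    assume "j \<noteq> 0"
    then have "m < 1 + m * j" using mult_le_mono2[of 1 j m] by linarith
    then have "CARD('a) * m < CARD('a) * (1 + m * j)" by (intro mult_strict_left_mono) simp_all
    then show False using W j by linarith
  qed
  then show ?thesis using j by simp
qed

lemma weight_difference:
  assumes "set_mset A \<subseteq> {e, g} \<union> common"
  shows "int (weight e A) - int (weight g A) = int k * (int r * int (count A g) - int q * int (count A e))"
  using assms
proof (induction A)
  case empty
  then show ?case by simp
next
  case (add h A)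
  then consider "h = e" | "h = g" | "h \<in> common" "h \<noteq> e" "h \<noteq> g" by auto
  then show ?case
  proof cases
    case 1
    then show ?thesis using add neq sigma_self[OF e(1)] sigma_g_e by (simp add: algebra_simps)
  next
    case 2
    then show ?thesis using add neq sigma_self[OF g(1)] qrk(5) by (simp add: algebra_simps)
  next
    case 3
    obtain t where "sigma e h = t" "sigma g h = t" using common_sigma[OF 3(1)] by metis
    then show ?thesis using add 3 by simp
  qed
qed

lemma gcd_dvd_norm:
  assumes \<gamma>: "\<gamma> = gcd CARD('a) (k * r)" and w: "w * \<gamma> = k * r" and A: "A \<in> atoms"
  shows "int CARD('a) * int (gcd k w) dvd int (weight e A) - int CARD('a)"
proof -
  obtain B where B: "B \<in> atoms" "weight e B = weight e A" "set_mset B \<subseteq> {e, g} \<union> common"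
    using ex_reduced_atom[OF A] by blast
  interpret swap: generator_pair G\<^sub>0 g e r q k by (rule swapped)
  have B': "set_mset B \<subseteq> {g, e} \<union> swap.common"
    using B(3) unfolding common_def swap.common_def by auto
  \<comment> \<open>If neither multiplicity is small, \<open>B\<close> contains \<open>r\<close>
    copies of \<open>e\<close> and \<open>q\<close> copies of \<open>g\<close>; these sum to zero
    with norm 1, so they are all of \<open>B\<close>.\<close>
  have "weight e B = CARD('a) \<or> weight g B = CARD('a)"
  proof -
    consider "count B g < q" | "count B e < r" | "r \<le> count B e" "q \<le> count B g" by linarith
    then show ?thesis
    proof cases
      case 1
      then show ?thesis using weight_eq_if_count_less[OF B(1,3)] by simp
    next
      case 2
      then show ?thesis using swap.weight_eq_if_count_less[OF B(1) B'] by simp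
    next
      case 3
      let ?T = "replicate_mset r e + replicate_mset q g"
      have T: "weight e ?T = CARD('a)" using n_eq(1) by (simp add: sigma_self[OF e(1)])
      moreover have "?T \<subseteq># B" using 3 neq by (intro mset_subset_eqI) auto
      moreover have "?T \<noteq> {#}" using qrk(1) by simp
      moreover have "\<Sum>\<^sub># ?T = 0" unfolding sum_mset_eq_0_iff[OF e(1)] T by simp
      ultimately show ?thesis using minimal_zero_sum_seqsD(4)[OF B(1), of ?T] by metis
    qed
  qed
  then show ?thesis
  proof
    assume "weight e B = CARD('a)"
    then show ?thesis using B(2) by simp
  next
    assume weight_g: "weight g B = CARD('a)"
    have "int CARD('a) dvd int (weight e B)"
      using minimal_zero_sum_seqsD(2)[OF B(1)] by (simp add: sum_mset_eq_0_iff[OF e(1)])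
    then have "int CARD('a) dvd int (weight e B) - int CARD('a)" by simp
    then obtain D where D: "int (weight e B) - int CARD('a) = int CARD('a) * D" by blast
    then have "int CARD('a) * D = int k * (int r * int (count B g) - int q * int (count B e))"
      using weight_difference[OF B(3)] weight_g by simp
    then have "int (gcd k w) dvd D"
      by (rule gcd_dvd_norm_difference[OF n qrk(1-3) \<gamma> w])
    then show ?thesis using D B(2) by simp
  qed
qed

text \<open>With \<open>c\<^sub>1 = r\<close> and \<open>c\<^sub>2 = q\<close> the quotients are
  \<open>k\<close> and \<open>k r d / n\<close>, so it remains to choose \<open>d\<close> such that
  their gcd is \<open>m\<close>.\<close>

lemma ex_M_set:
  "\<exists>d. (r, q, d) \<in> M_set CARD('a) \<and> real (sigma e g) = (real CARD('a) - real r) / real q \<and>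
    iterate_add d e = iterate_add d g \<and> int m = quot_gcd CARD('a) r q d"
proof -
  define \<gamma> where "\<gamma> = gcd CARD('a) (k * r)"
  have \<gamma>0: "\<gamma> \<noteq> 0" by (simp add: \<gamma>_def)
  obtain w n' where w: "k * r = w * \<gamma>" and n': "CARD('a) = n' * \<gamma>" unfolding \<gamma>_def
    using gcd_dvd1 gcd_dvd2 by (metis dvdE mult.commute)
  have "int (gcd k w) dvd int m"
    using gcd_dvd_norm[OF \<gamma>_def w[symmetric]]
    by (intro dvd_min_distance[OF _ _ pos, of "int CARD('a)" _ "\<lambda>h. int (sigma e h)"])
      (simp_all add: weight_def of_nat_sum_mset multiset.map_comp comp_def)
  then have gm: "gcd k w dvd m" by simp
  \<comment> \<open>This makes \<open>w * f\<close> the lcm of \<open>m\<close> and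
    \<open>w\<close>.\<close>
  define f where "f = m div gcd m w"
  have gcd_wf: "gcd k (w * f) = m"
    unfolding f_def using gcd_lcm_adjust[OF gm qrk(4)] qrk(3) by simp
  have f0: "f \<noteq> 0" unfolding f_def using pos by (simp add: div_eq_0_iff not_less dvd_imp_le)
  \<comment> \<open>Needed for \<open>d\<close> to divide the order: \<open>m\<close> divides
    \<open>k r = w \<gamma>\<close>, and \<open>f\<close> is coprime to
    \<open>w div gcd m w\<close>.\<close>
  have "f dvd \<gamma>"
  proof -
    have "coprime f (w div gcd m w)" unfolding f_def using pos by (intro div_gcd_coprime) simp
    moreover have "f dvd (w div gcd m w) * \<gamma>"
    proof -
      have "m dvd w * \<gamma>" using qrk(4) w by (metis dvd_mult2)
      then have "gcd m w * f dvd gcd m w * ((w div gcd m w) * \<gamma>)" by (simp add: f_def flip: mult.assoc)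
      then show ?thesis using pos by simp
    qed
    ultimately show ?thesis by (simp add: coprime_dvd_mult_right_iff)
  qed
  \<comment> \<open>Then \<open>d k r\<close> is \<open>w f\<close> times the order; this gives both
    the second quotient and \<open>d e = d g\<close>.\<close>
  define d where "d = n' * f"
  have d_dvd: "d dvd CARD('a)" unfolding d_def n' using \<open>f dvd \<gamma>\<close> by (rule mult_dvd_mono[OF dvd_refl])
  have d0: "0 < d" using d_dvd by (intro gr0I) simp
  have dkr: "d * (k * r) = CARD('a) * (w * f)" unfolding d_def w n' by (simp add: mult_ac)
  have nreal: "real CARD('a) - real r - real q = real (q * r * k)" using n by simp
  have q1: "quot1 CARD('a) r q = real k" unfolding quot1_def nreal using qrk(1,2) by simp
  have q2: "quot2 CARD('a) r q d = real (w * f)"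
  proof -
    have "real (q * r * k) * real d = real q * real (d * (k * r))" by simp
    also have "\<dots> = real (w * f) * (real q * real CARD('a))" unfolding dkr by simp
    finally show ?thesis unfolding quot2_def nreal using qrk(1) by simp
  qed
  have wf: "0 < w * f" using w f0 qrk(2,3) by (auto intro: gr0I)
  have "r \<le> CARD('a)" "q \<le> CARD('a)" using n by simp_all
  then have "(r, q, d) \<in> M_set CARD('a)"
    unfolding M_set_def using qrk(1-3) d_dvd d0 wf by (simp add: q1 q2 del: of_nat_mult)
  moreover have "real (sigma e g) = (real CARD('a) - real r) / real q"
    using n_eq(1) qrk(1) by (simp add: field_simps)
  moreover have "iterate_add d e = iterate_add d g"
  proof -
    have "iterate_add d g = iterate_add (d * sigma e g) e"
      using sigma(3)[OF e(1), of g] by (simp only: iterate_add_mult)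
    also have "d * sigma e g = (w * f) * CARD('a) + d" using dkr unfolding qrk(5) by (simp add: algebra_simps)
    also have "iterate_add \<dots> e = iterate_add d e"
      unfolding iterate_add_distrib iterate_add_mult[of "w * f"] iterate_add_card by simp
    finally show ?thesis ..
  qed
  moreover have "int m = quot_gcd CARD('a) r q d"
    unfolding quot_gcd_def q1 q2 floor_of_nat using gcd_wf by (simp only: gcd_int_int_eq)
  ultimately show ?thesis by blast
qed

end

theorem theorem6p2:
  fixes G\<^sub>0 :: "'a::{finite, ab_group_add} set"
  assumes cyclic: "\<exists>x::'a. generating x"
    and two_generators: "card {x \<in> G\<^sub>0. generating x} \<ge> 2"
    and large: "real (min_distance G\<^sub>0) \<ge> (2 * real (CARD('a)) ^ 2) powr (1 / 3)"
  shows "int (min_distance G\<^sub>0) \<in> I_set (CARD('a)) \<and>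
    card {x \<in> G\<^sub>0. generating x} = 2 \<and>
    (\<forall>e g. {x \<in> G\<^sub>0. generating x} = {e, g} \<longrightarrow>
      (\<exists>c\<^sub>1 c\<^sub>2 d. (c\<^sub>1, c\<^sub>2, d) \<in> M_set (CARD('a)) \<and>
        real (sigma e g) = (real (CARD('a)) - real c\<^sub>1) / real c\<^sub>2 \<and>
        iterate_add d e = iterate_add d g \<and>
        int (min_distance G\<^sub>0) = quot_gcd (CARD('a)) c\<^sub>1 c\<^sub>2 d))"
proof -
  let ?S = "{x \<in> G\<^sub>0. generating x}"
  let ?R = "\<lambda>e g c\<^sub>1 c\<^sub>2 d. (c\<^sub>1, c\<^sub>2, d) \<in> M_set (CARD('a)) \<and>
        real (sigma e g) = (real (CARD('a)) - real c\<^sub>1) / real c\<^sub>2 \<and>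
        iterate_add d e = iterate_add d g \<and>
        int (min_distance G\<^sub>0) = quot_gcd (CARD('a)) c\<^sub>1 c\<^sub>2 d"
  have "2 * real (CARD('a)) ^ 2 = ((2 * real (CARD('a)) ^ 2) powr (1 / 3)) ^ 3"
    by (simp add: powr_power)
  also have "\<dots> \<le> real (min_distance G\<^sub>0) ^ 3" using large by (intro power_mono) auto
  finally have "real (2 * CARD('a) ^ 2) \<le> real (min_distance G\<^sub>0 ^ 3)" by simp
  then interpret large_min_distance G\<^sub>0
    by unfold_locales (simp only: of_nat_le_iff)
  have pair: "\<exists>c\<^sub>1 c\<^sub>2 d. ?R e g c\<^sub>1 c\<^sub>2 d" if "e \<in> ?S" "g \<in> ?S" "e \<noteq> g" for e g
  proof -
    have eg: "generating e" "e \<in> G\<^sub>0" "generating g" "g \<in> G\<^sub>0" using that by auto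
    obtain q r k where *: "1 \<le> q" "1 \<le> r" "1 \<le> k" "m dvd k" "sigma e g = k * r + 1"
      "sigma g e = k * q + 1" "CARD('a) = q * r * k + q + r"
      using generator_pair_structure[OF eg \<open>e \<noteq> g\<close>] .
    then interpret generator_pair G\<^sub>0 e g q r k
      using eg \<open>e \<noteq> g\<close> by unfold_locales
    show ?thesis using ex_M_set by blast
  qed
  obtain e g where eg: "e \<in> ?S" "g \<in> ?S" "e \<noteq> g"
    using two_generators card_le_Suc0_iff_eq[of ?S] by (metis finite not_less_eq_eq numeral_2_eq_2)
  \<comment> \<open>A generator has \<open>t = 1\<close>, so the classification by multiples leaves
    only \<open>e\<close> and \<open>g\<close>.\<close>
  have "h = e \<or> h = g" if "h \<in> ?S" for h
  proof -
    have "1 = gcd (sigma e h) CARD('a)"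
      using coprime_sigma[of e h] eg that by (simp add: coprime_iff_gcd_eq_1)
    then have "h = iterate_add 1 e \<or> h = iterate_add 1 g"
      using eg that by (intro multiple_of_generator) auto
    then show ?thesis by simp
  qed
  then have "?S = {e, g}" using eg by blast
  then have card: "card ?S = 2" using eg(3) by simp
  have "int (min_distance G\<^sub>0) \<in> I_set (CARD('a))"
    using pair[OF eg] unfolding I_set_def by blast
  \<comment> \<open>The names \<open>e\<close> and \<open>g\<close> are rebound here, so both orders
    of the pair are covered.\<close>
  moreover have "\<exists>c\<^sub>1 c\<^sub>2 d. ?R e g c\<^sub>1 c\<^sub>2 d" if S: "?S = {e, g}" for e g
  proof (rule pair)
    show "e \<in> ?S" "g \<in> ?S" unfolding S by simp_all
    show "e \<noteq> g" using card unfolding S by (intro notI) simp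
  qed
  ultimately show ?thesis using card by blast
qed

end
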